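(* There exists a universal constant $C<\infty$ with the following property. For any alphabet size $k$ there exist points $a_1,\dots,a_k\in\mathbb R^{\lceil C\log k\rceil}$ such that, given an i.i.d. sample $X_1,\dots,X_n\sim\nu$ from an unknown $\nu\in\mathcal P_k$, any estimator $\tilde\nu\in\mathcal P_k$ satisfying, for some $c\ge0$, $$\mathcal E_1^2\Big(\sum_{i=1}^k\tilde\nu_i\delta_{a_i},\ \frac1n\sum_{i=1}^n\delta_{a_{X_i}}\Big)\le\frac cn\qquad( * )$$ enjoys the guarantee $$\sup_{\nu\in\mathcal P_k}\mathbb E\,\mathsf{TV}^2(\tilde\nu,\nu)\le C\min\Big\{(c+1)\frac{k\sqrt{\log k}}n,\ 1\Big\}.$$ Moreover, $\mathcal E_1$ may be replaced by $\overline{d_H}$ in $( * )$, and then the guarantee remains true with $\sqrt{\log k}$ replaced by $\log k$.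
   Context: $\mathcal P_k$ is the set of probability distributions on $[k]=\{1,\dots,k\}$; for $\mu\in\mathcal P_k$, $\mu_i$ is the mass at $i$. $\mathsf{TV}(\mu,\nu)=\sup_A[\mu(A)-\nu(A)]$. For probability distributions $\mu,\nu$ on $\mathbb R^d$ with finite mean, $\mathcal E_1^2(\mu,\nu)=\mathbb E\big[2\|X-Y\|-\|X-X'\|-\|Y-Y'\|\big]$ with $(X,X',Y,Y')\sim\mu^{\otimes2}\otimes\nu^{\otimes2}$, and $\overline{d_H}(\mu,\nu)=\sup_{v\in\mathbb R^d,b\in\mathbb R}\{\mu(\{x:x^\top v\ge b\})-\nu(\{x:x^\top v\ge b\})\}$. *)

theory Defs
  imports "HOL-Probability.Probability" "Jordan_Normal_Form.Matrix"
begin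

definition prob_dists :: "nat \<Rightarrow> nat pmf set" where
  "prob_dists k = {\<mu>. set_pmf \<mu> \<subseteq> {1..k}}"

definition tv_dist :: "'a pmf \<Rightarrow> 'a pmf \<Rightarrow> real" where
  "tv_dist \<mu> \<nu> = (SUP A. measure_pmf.prob \<mu> A - measure_pmf.prob \<nu> A)"

text \<open>
  Since the dimension depends on the alphabet size, points of \<open>\<real>\<^sup>d\<close> are vectors in
  \<^term>\<open>carrier_vec d\<close>. All distributions on \<open>\<real>\<^sup>d\<close> that are compared below have finite support,
  so the two discrepancies are defined for discrete distributions (concentrated on
  \<^term>\<open>carrier_vec d\<close>); the mean, and with it every expectation, is then finite.
\<close>

definition eucl_norm :: "real vec \<Rightarrow> real" where
  "eucl_norm x = sqrt (scalar_prod x x)"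

definition energy_dist_sq :: "real vec pmf \<Rightarrow> real vec pmf \<Rightarrow> real" where
  "energy_dist_sq \<mu> \<nu> =
     measure_pmf.expectation (pair_pmf \<mu> (pair_pmf \<mu> (pair_pmf \<nu> \<nu>)))
       (\<lambda>(x, x', y, y'). 2 * eucl_norm (x - y) - eucl_norm (x - x') - eucl_norm (y - y'))"

definition halfspace_dist :: "nat \<Rightarrow> real vec pmf \<Rightarrow> real vec pmf \<Rightarrow> real" where
  "halfspace_dist d \<mu> \<nu> =
     (SUP (v, b) \<in> carrier_vec d \<times> (UNIV :: real set).
        measure_pmf.prob \<mu> {x \<in> carrier_vec d. scalar_prod x v \<ge> b}
      - measure_pmf.prob \<nu> {x \<in> carrier_vec d. scalar_prod x v \<ge> b})"

text \<open>
  A sample \<open>X\<^sub>1, \<dots>, X\<^sub>n\<close> is a function on \<^term>\<open>{1..n}\<close> (with value \<^const>\<open>undefined\<close> elsewhere),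
  and an estimator is a function from samples to \<^term>\<open>prob_dists k\<close>. The set of samples is
  finite, so no measurability condition is needed.
\<close>

definition samples :: "nat \<Rightarrow> nat \<Rightarrow> (nat \<Rightarrow> nat) set" where
  "samples k n = {1..n} \<rightarrow>\<^sub>E {1..k}"

definition iid_sample :: "nat \<Rightarrow> nat pmf \<Rightarrow> (nat \<Rightarrow> nat) pmf" where
  "iid_sample n \<nu> = Pi_pmf {1..n} undefined (\<lambda>_. \<nu>)"

text \<open>The empirical measure of \<open>a (X\<^sub>1), \<dots>, a (X\<^sub>n)\<close>; meaningful for \<open>n \<ge> 1\<close> only.\<close>

definition empirical :: "(nat \<Rightarrow> 'a) \<Rightarrow> nat \<Rightarrow> (nat \<Rightarrow> nat) \<Rightarrow> 'a pmf" where
  "empirical a n X = map_pmf (\<lambda>i. a (X i)) (pmf_of_set {1..n})"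

definition max_tv_risk :: "nat \<Rightarrow> nat \<Rightarrow> ((nat \<Rightarrow> nat) \<Rightarrow> nat pmf) \<Rightarrow> real" where
  "max_tv_risk k n T =
     (SUP \<nu> \<in> prob_dists k. measure_pmf.expectation (iid_sample n \<nu>) (\<lambda>X. (tv_dist (T X) \<nu>)\<^sup>2))"

end

theory Submission
  imports Defs "HOL-Real_Asymp.Real_Asymp"
begin

text \<open>
  Take the points to be normalised sign vectors with pairwise inner products at most \<open>1/2\<close> in absolute
  value. For a signed measure of total mass zero with weights \<open>w\<close>, the energy distance is
  \<open>Q(w) = - \<Sum>\<^sub>i\<^sub>j w\<^sub>i w\<^sub>j \<parallel>a\<^sub>i - a\<^sub>j\<parallel>\<close>. Since \<open>\<parallel>x - y\<parallel> = sqrt 2 * sqrt (1 - \<langle>x, y\<rangle>)\<close> on the sphere and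
  \<open>1 - sqrt (1 - s)\<close> has nonnegative Taylor coefficients, \<open>Q\<close> is a nonnegative combination of the
  entrywise powers of the Gram matrix. All these powers are positive semidefinite, and from the power
  \<open>M \<approx> log\<^sub>2 (2k)\<close> on they are diagonally dominant. The Taylor coefficients beyond \<open>M\<close> add up to at
  least \<open>1 / (2 sqrt M)\<close>, so \<open>Q(w)\<close> dominates \<open>\<Sum>\<^sub>i w\<^sub>i\<^sup>2 / sqrt (log k)\<close>, hence, by Cauchy-Schwarz,
  \<open>TV\<^sup>2 / (k sqrt (log k))\<close>. As \<open>sqrt Q\<close> is a seminorm and the empirical measure has expected
  squared distance at most \<open>2/n\<close> from \<open>\<nu>\<close>, the first bound follows.

  For half-spaces, \<open>\<parallel>z\<parallel>\<close> is proportional to the mean of \<open>\<bar>\<langle>z, g\<rangle>\<bar>\<close> for a standard Gaussian vector \<open>g\<close>,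
  and on a line \<open>- \<Sum>\<^sub>i\<^sub>j w\<^sub>i w\<^sub>j \<bar>s\<^sub>i - s\<^sub>j\<bar>\<close> is twice the integral over \<open>b\<close> of the squared \<open>w\<close>-mass of
  \<open>{s \<ge> b}\<close>. Thus \<open>Q\<close> of the difference of the estimate and the empirical measure is at most
  \<open>6 sqrt d\<close> times the squared half-space distance, and \<open>sqrt d\<close> is of order \<open>sqrt (log k)\<close>. The step
  from the empirical measure to \<open>\<nu>\<close> still uses \<open>Q\<close>, so no uniform bound over half-spaces is needed.
\<close>

subsection \<open>The quadratic form of a distance matrix\<close>

text \<open>The minus sign makes the form nonnegative on weights of total mass zero when
  \<open>D\<close> is a Euclidean distance. \<open>D\<close> is an arbitrary kernel so that
  indicators of intervals can take the place of distances.\<close>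

definition distance_form :: "'a set \<Rightarrow> ('a \<Rightarrow> 'a \<Rightarrow> real) \<Rightarrow> ('a \<Rightarrow> real) \<Rightarrow> real" where
  "distance_form I D w = - (\<Sum>i\<in>I. \<Sum>j\<in>I. w i * w j * D i j)"

text \<open>Parallelogram identity. It stands in for the triangle inequality of the seminorm given
  by the square root of the form.\<close>

lemma distance_form_add_le:
  assumes "distance_form I D (\<lambda>i. u i - v i) \<ge> 0"
  shows "distance_form I D (\<lambda>i. u i + v i) \<le> 2 * distance_form I D u + 2 * distance_form I D v"
proof -
  have "distance_form I D (\<lambda>i. u i + v i) + distance_form I D (\<lambda>i. u i - v i)
      = 2 * distance_form I D u + 2 * distance_form I D v"
    unfolding distance_form_def
    by (simp add: algebra_simps sum_distrib_left flip: sum.distrib sum_negf)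
  then show ?thesis using assms by simp
qed

lemma distance_form_scale: "distance_form I (\<lambda>i j. c * D i j) w = c * distance_form I D w"
  by (simp add: distance_form_def sum_distrib_left mult_ac)

text \<open>Schur product argument: one factor \<open>s i j\<close> is expanded and absorbed into
  the weights, which become \<open>w i * x i l\<close> for each \<open>l\<close>. Hence the
  induction is over all \<open>w\<close> at once.\<close>

lemma gram_power_nonneg:
  fixes x :: "'a \<Rightarrow> 'b \<Rightarrow> real"
  assumes s: "\<And>i j. i \<in> I \<Longrightarrow> j \<in> I \<Longrightarrow> s i j = (\<Sum>l\<in>L. x i l * x j l)"
  shows "0 \<le> (\<Sum>i\<in>I. \<Sum>j\<in>I. w i * w j * s i j ^ m)"
proof (induction m arbitrary: w)
  case 0
  have "(\<Sum>i\<in>I. \<Sum>j\<in>I. w i * w j) = (\<Sum>i\<in>I. w i)\<^sup>2"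
    by (simp add: power2_eq_square sum_product)
  then show ?case by simp
next
  case (Suc m)
  have "(\<Sum>i\<in>I. \<Sum>j\<in>I. w i * w j * s i j ^ Suc m)
      = (\<Sum>i\<in>I. \<Sum>j\<in>I. \<Sum>l\<in>L. (w i * x i l) * (w j * x j l) * s i j ^ m)"
    by (intro sum.cong refl) (simp add: s sum_distrib_left sum_distrib_right mult_ac)
  also have "\<dots> = (\<Sum>i\<in>I. \<Sum>l\<in>L. \<Sum>j\<in>I. (w i * x i l) * (w j * x j l) * s i j ^ m)"
    by (intro sum.cong refl sum.swap)
  also have "\<dots> = (\<Sum>l\<in>L. \<Sum>i\<in>I. \<Sum>j\<in>I. (w i * x i l) * (w j * x j l) * s i j ^ m)"
    by (rule sum.swap)
  also have "\<dots> \<ge> 0"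
    by (intro sum_nonneg Suc.IH)
  finally show ?case .
qed

lemma double_sum_diag_dominant:
  fixes w :: "'a \<Rightarrow> real"
  assumes I: "finite I" and card: "real (card I) * \<epsilon> \<le> 1/2" and \<epsilon>: "\<epsilon> \<ge> 0"
    and diag: "\<And>i. i \<in> I \<Longrightarrow> t i i = 1"
    and off: "\<And>i j. i \<in> I \<Longrightarrow> j \<in> I \<Longrightarrow> i \<noteq> j \<Longrightarrow> \<bar>t i j\<bar> \<le> \<epsilon>"
  shows "(\<Sum>i\<in>I. \<Sum>j\<in>I. w i * w j * t i j) \<ge> (\<Sum>i\<in>I. (w i)\<^sup>2) / 2"
proof -
  \<comment> \<open>AM-GM bounds the off-diagonal terms. The penalty is subtracted on the diagonal
    too, so that the double sum splits and costs \<open>card I * \<epsilon>\<close> times the sum of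
    squares in total.\<close>
  have ptw: "w i * w j * t i j \<ge> (if i = j then (w i)\<^sup>2 else 0) - \<epsilon> / 2 * ((w i)\<^sup>2 + (w j)\<^sup>2)"
    if "i \<in> I" "j \<in> I" for i j
  proof (cases "i = j")
    case True
    then show ?thesis using that diag \<epsilon> by (simp add: power2_eq_square)
  next
    case False
    have "\<bar>w i * w j * t i j\<bar> \<le> \<bar>w i * w j\<bar> * \<epsilon>"
      using off[OF that False] by (simp add: abs_mult mult_left_mono)
    also have "\<bar>w i * w j\<bar> * \<epsilon> \<le> (((w i)\<^sup>2 + (w j)\<^sup>2) / 2) * \<epsilon>"
      using sum_squares_bound[of "\<bar>w i\<bar>" "\<bar>w j\<bar>"] \<epsilon>
      by (intro mult_right_mono) (auto simp: abs_mult)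
    also have "\<dots> = \<epsilon> / 2 * ((w i)\<^sup>2 + (w j)\<^sup>2)"
      by simp
    finally show ?thesis using False by auto
  qed
  have "(\<Sum>i\<in>I. (w i)\<^sup>2) / 2 \<le> (\<Sum>i\<in>I. (w i)\<^sup>2) - \<epsilon> * real (card I) * (\<Sum>i\<in>I. (w i)\<^sup>2)"
    using mult_right_mono[OF card, of "\<Sum>i\<in>I. (w i)\<^sup>2"] by (simp add: sum_nonneg mult_ac)
  also have "\<dots> = (\<Sum>i\<in>I. \<Sum>j\<in>I. (if i = j then (w i)\<^sup>2 else 0) - \<epsilon> / 2 * ((w i)\<^sup>2 + (w j)\<^sup>2))"
  proof -
    have "(\<Sum>i\<in>I. \<Sum>j\<in>I. (w i)\<^sup>2 + (w j)\<^sup>2) = 2 * real (card I) * (\<Sum>i\<in>I. (w i)\<^sup>2)"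
      by (simp add: sum.distrib sum_distrib_left mult.assoc)
    then show ?thesis
      using I unfolding sum_subtractf sum_distrib_left[symmetric] by simp
  qed
  also have "\<dots> \<le> (\<Sum>i\<in>I. \<Sum>j\<in>I. w i * w j * t i j)"
    by (intro sum_mono ptw)
  finally show ?thesis .
qed

subsection \<open>The Taylor series of the square root\<close>

text \<open>Equal to \<open>(2m choose m) / 4\<^sup>m\<close>, the sum of the Taylor coefficients of \<open>1 - sqrt (1 - s)\<close> of degree
  above \<open>m\<close>.\<close>

definition central_ratio :: "nat \<Rightarrow> real" where
  "central_ratio m = (\<Prod>j<m. 1 - 1 / (2 * real (Suc j)))"

lemma central_ratio_Suc:
  "central_ratio (Suc m) = central_ratio m * (1 - 1 / (2 * real (Suc m)))"
  by (simp add: central_ratio_def)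

lemma central_ratio_nonneg: "0 \<le> central_ratio m"
  by (simp add: central_ratio_def prod_nonneg)

lemma central_ratio_antimono: "central_ratio (Suc m) \<le> central_ratio m"
  unfolding central_ratio_Suc
  by (intro mult_left_le central_ratio_nonneg) simp

text \<open>The quantity \<open>m * (central_ratio m)^2\<close> is nondecreasing and equals 1/4 at
  \<open>m = 1\<close>; \<open>aux\<close> with \<open>z = m + 1\<close> is the induction
  step.\<close>

lemma central_ratio_lower: "m \<ge> 1 \<Longrightarrow> 1 / (2 * sqrt (real m)) \<le> central_ratio m"
proof -
  assume m: "m \<ge> 1"
  have aux: "(z - 1) * c\<^sup>2 \<le> z * (c * (1 - 1 / (2 * z)))\<^sup>2" if "z > 0" for z c :: real
  proof -
    have "z * (c * (1 - 1 / (2 * z)))\<^sup>2 = (z - 1) * c\<^sup>2 + c\<^sup>2 / (4 * z)"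
      using that by (simp add: power2_eq_square field_simps)
    then show ?thesis using that by simp
  qed
  have "1 / 4 \<le> real m * (central_ratio m)\<^sup>2"
    using m
  proof (induction m rule: dec_induct)
    case base
    then show ?case by (simp add: central_ratio_def power2_eq_square)
  next
    case (step m)
    then show ?case
      using aux[of "real (Suc m)" "central_ratio m"]
      unfolding central_ratio_Suc by simp
  qed
  then have "(1 / (2 * sqrt (real m)))\<^sup>2 \<le> (central_ratio m)\<^sup>2"
    using m by (simp add: power_divide power_mult_distrib field_simps)
  then show ?thesis
    using power2_le_imp_le central_ratio_nonneg by blast
qed

text \<open>Here \<open>(2 * m + 1) * (central_ratio m)^2\<close> is nonincreasing and equals 1 at
  \<open>m = 0\<close>, which gives decay of order \<open>1 / sqrt m\<close>.\<close>

lemma central_ratio_tendsto: "central_ratio \<longlonglongrightarrow> 0"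
proof -
  have step: "(2 * z + 1) * (c * (1 - 1 / (2 * z)))\<^sup>2 \<le> (2 * z - 1) * c\<^sup>2" if "z \<ge> 1" for z c :: real
  proof -
    have "(2 * z + 1) * (c * (1 - 1 / (2 * z)))\<^sup>2 = (2 * z - 1) * c\<^sup>2 - (2 * z - 1) * c\<^sup>2 / (4 * z\<^sup>2)"
      using that by (simp add: power2_eq_square field_simps)
    then show ?thesis using that by simp
  qed
  have *: "(2 * real m + 1) * (central_ratio m)\<^sup>2 \<le> 1" for m
  proof (induction m)
    case 0
    then show ?case by (simp add: central_ratio_def)
  next
    case (Suc m)
    then show ?case
      using step[of "real (Suc m)" "central_ratio m"]
      unfolding central_ratio_Suc by (simp add: add.commute)
  qed
  have upper: "central_ratio m \<le> 1 / sqrt (2 * real m + 1)" for m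
  proof (rule power2_le_imp_le)
    show "(central_ratio m)\<^sup>2 \<le> (1 / sqrt (2 * real m + 1))\<^sup>2"
      using *[of m] by (simp add: power_divide field_simps)
  qed simp
  have lim: "(\<lambda>m. 1 / sqrt (2 * real m + 1)) \<longlonglongrightarrow> 0"
    by real_asymp
  show ?thesis
    by (rule tendsto_sandwich[OF _ _ tendsto_const lim]) (simp_all add: upper central_ratio_nonneg)
qed

text \<open>The Taylor coefficient of degree \<open>m + 1\<close>.\<close>

definition sqrt_coeff :: "nat \<Rightarrow> real" where
  "sqrt_coeff m = central_ratio m - central_ratio (Suc m)"

lemma sqrt_coeff_eq: "sqrt_coeff m = central_ratio m / (2 * real (Suc m))"
  by (simp add: sqrt_coeff_def central_ratio_Suc right_diff_distrib)

lemma sqrt_coeff_nonneg: "0 \<le> sqrt_coeff m"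
  using central_ratio_antimono by (simp add: sqrt_coeff_def)

lemma sqrt_coeff_tail_sums: "(\<lambda>m. sqrt_coeff (m + M)) sums central_ratio M"
proof -
  have "(\<lambda>m. central_ratio (m + M)) \<longlonglongrightarrow> 0"
    using central_ratio_tendsto by (rule LIMSEQ_ignore_initial_segment)
  from telescope_sums'[OF this] show ?thesis
    by (simp add: sqrt_coeff_def)
qed

text \<open>Links the coefficients to the generalised binomial series of exponent 1/2. From index
  \<open>m\<close> to \<open>m + 1\<close> both sides are multiplied by
  \<open>(m + 1/2) / (m + 2)\<close>.\<close>

lemma gchoose_half_Suc:
  "((1/2::real) gchoose (Suc m)) * (-1) ^ Suc m = - sqrt_coeff m"
proof (induction m)
  case 0
  then show ?case by (simp add: sqrt_coeff_def central_ratio_def)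
next
  case (Suc m)
  have r: "((1/2::real) gchoose (Suc (Suc m))) = (1/2 gchoose (Suc m)) * ((1/2 - real (Suc m)) / real (Suc (Suc m)))"
    using gbinomial_mult_1[of "1/2::real" "Suc m"] by (simp add: field_simps del: gbinomial_Suc)
  have "((1/2::real) gchoose (Suc (Suc m))) * (-1) ^ Suc (Suc m)
     = ((1/2 gchoose (Suc m)) * (-1) ^ Suc m) * ((real (Suc m) - 1/2) / real (Suc (Suc m)))"
    unfolding r by (simp add: field_simps)
  also have "\<dots> = - sqrt_coeff (Suc m)"
  proof -
    have "- (c / (2 * z)) * ((z - 1/2) / v) = - (c * (1 - 1 / (2 * z)) / (2 * v))"
      if "z > 0" "v > 0" for z v c :: real
      using that by (simp add: field_simps)
    from this[of "real (Suc m)" "real (Suc (Suc m))" "central_ratio m"] show ?thesis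
      unfolding Suc sqrt_coeff_eq central_ratio_Suc by simp
  qed
  finally show ?case .
qed

text \<open>The binomial series covers the open interval. The endpoint \<open>s = 1\<close>, which
  occurs on the diagonal of the Gram matrix, comes from telescoping.\<close>

lemma one_minus_sqrt_sums:
  fixes s :: real
  assumes "\<bar>s\<bar> < 1 \<or> s = 1"
  shows "(\<lambda>m. sqrt_coeff m * s ^ Suc m) sums (1 - sqrt (1 - s))"
  using assms
proof
  assume "s = 1"
  then show ?thesis
    using sqrt_coeff_tail_sums[of 0] by (simp add: central_ratio_def)
next
  assume s: "\<bar>s\<bar> < 1"
  have "(\<lambda>m. (1/2 gchoose m) * (- s) ^ m) sums (1 + (- s)) powr (1/2)"
    using s by (intro gen_binomial_real) simp
  then have "(\<lambda>m. (1/2 gchoose (Suc m)) * (- s) ^ Suc m) sums (sqrt (1 - s) - 1)"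
    using s by (subst sums_Suc_iff) (simp add: powr_half_sqrt)
  moreover have "(1/2 gchoose (Suc m)) * (- s) ^ Suc m = - (sqrt_coeff m * s ^ Suc m)" for m
    using gchoose_half_Suc[of m] power_minus[of s "Suc m"]
    by (metis (no_types, opaque_lifting) mult.assoc mult_minus_left)
  ultimately have "(\<lambda>m. - (sqrt_coeff m * s ^ Suc m)) sums (sqrt (1 - s) - 1)"
    by (simp only:)
  from sums_minus[OF this] show ?thesis by simp
qed

lemma distance_form_lower:
  fixes x :: "'a \<Rightarrow> 'b \<Rightarrow> real"
  assumes I: "finite I"
    and s: "\<And>i j. i \<in> I \<Longrightarrow> j \<in> I \<Longrightarrow> s i j = (\<Sum>l\<in>L. x i l * x j l)"
    and diag: "\<And>i. i \<in> I \<Longrightarrow> s i i = 1"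
    and off: "\<And>i j. i \<in> I \<Longrightarrow> j \<in> I \<Longrightarrow> i \<noteq> j \<Longrightarrow> \<bar>s i j\<bar> \<le> 1/2"
    and w: "(\<Sum>i\<in>I. w i) = 0"
    and M: "M \<ge> 1" "2 * real (card I) \<le> 2 ^ M"
  shows "distance_form I (\<lambda>i j. sqrt (1 - s i j)) w \<ge> (\<Sum>i\<in>I. (w i)\<^sup>2) / (4 * sqrt (real M))"
proof -
  define P where "P m = (\<Sum>i\<in>I. \<Sum>j\<in>I. w i * w j * s i j ^ m)" for m
  define W where "W = (\<Sum>i\<in>I. (w i)\<^sup>2)"
  have P0: "P m \<ge> 0" for m
    unfolding P_def by (rule gram_power_nonneg[OF s])
  \<comment> \<open>Off the diagonal the power is at most \<open>(1/2) ^ Suc (m + M)\<close>, and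
    \<open>2 * card I <= 2 ^ M\<close> makes the rows diagonally dominant.\<close>
  have PM: "P (Suc (m + M)) \<ge> W / 2" for m
    unfolding P_def W_def
  proof (rule double_sum_diag_dominant[OF I, where \<epsilon> = "(1/2) ^ Suc (m + M)"])
    have "real (card I) * (1/2) ^ Suc (m + M) \<le> real (card I) * (1/2) ^ M"
      by (intro mult_left_mono power_decreasing) auto
    also have "\<dots> \<le> 1/2" using M by (simp add: power_one_over field_simps)
    finally show "real (card I) * (1/2) ^ Suc (m + M) \<le> 1/2" .
    fix i j assume "i \<in> I" "j \<in> I" "i \<noteq> j"
    then show "\<bar>s i j ^ Suc (m + M)\<bar> \<le> (1/2) ^ Suc (m + M)"
      unfolding power_abs by (intro power_mono off) auto
  qed (use diag in auto)
  have "(\<lambda>m. \<Sum>i\<in>I. \<Sum>j\<in>I. w i * w j * (sqrt_coeff m * s i j ^ Suc m)) sums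
        (\<Sum>i\<in>I. \<Sum>j\<in>I. w i * w j * (1 - sqrt (1 - s i j)))"
  proof (intro sums_sum sums_mult one_minus_sqrt_sums)
    fix i j assume "i \<in> I" "j \<in> I"
    then show "\<bar>s i j\<bar> < 1 \<or> s i j = 1"
      using diag[of i] off[of i j] by (cases "i = j") auto
  qed
  also have "(\<lambda>m. \<Sum>i\<in>I. \<Sum>j\<in>I. w i * w j * (sqrt_coeff m * s i j ^ Suc m)) = (\<lambda>m. sqrt_coeff m * P (Suc m))"
    by (simp add: P_def sum_distrib_left mult_ac)
  \<comment> \<open>The constant 1 contributes the square of the total mass, which vanishes.\<close>
  also have "(\<Sum>i\<in>I. \<Sum>j\<in>I. w i * w j * (1 - sqrt (1 - s i j)))
      = (\<Sum>i\<in>I. w i) * (\<Sum>i\<in>I. w i) + distance_form I (\<lambda>i j. sqrt (1 - s i j)) w"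
    by (simp add: distance_form_def sum_product right_diff_distrib sum_subtractf)
  also have "\<dots> = distance_form I (\<lambda>i j. sqrt (1 - s i j)) w"
    using w by simp
  finally have sums: "(\<lambda>m. sqrt_coeff m * P (Suc m)) sums distance_form I (\<lambda>i j. sqrt (1 - s i j)) w" .
  \<comment> \<open>Degrees 1 to \<open>M\<close> are discarded as nonnegative. Each later degree
    has \<open>P\<close> at least \<open>W / 2\<close>, and the coefficients there add up to
    \<open>central_ratio M\<close>.\<close>
  have "(\<Sum>m<M. sqrt_coeff m * P (Suc m)) \<ge> 0"
    by (intro sum_nonneg mult_nonneg_nonneg sqrt_coeff_nonneg P0)
  have "W / (4 * sqrt (real M)) = 1 / (2 * sqrt (real M)) * (W / 2)"
    by simp
  also have "\<dots> \<le> central_ratio M * (W / 2)"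
    using M by (intro mult_right_mono central_ratio_lower) (auto simp: W_def sum_nonneg)
  also have "\<dots> \<le> distance_form I (\<lambda>i j. sqrt (1 - s i j)) w - (\<Sum>m<M. sqrt_coeff m * P (Suc m))"
  proof (rule sums_le)
    show "(\<lambda>m. sqrt_coeff (m + M) * (W / 2)) sums (central_ratio M * (W / 2))"
      by (intro sums_mult2 sqrt_coeff_tail_sums)
    show "(\<lambda>m. sqrt_coeff (m + M) * P (Suc (m + M))) sums
        (distance_form I (\<lambda>i j. sqrt (1 - s i j)) w - (\<Sum>m<M. sqrt_coeff m * P (Suc m)))"
      using sums by (subst sums_iff_shift) simp
    show "sqrt_coeff (m + M) * (W / 2) \<le> sqrt_coeff (m + M) * P (Suc (m + M))" for m
      by (intro mult_left_mono PM sqrt_coeff_nonneg)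
  qed
  finally show ?thesis
    using \<open>(\<Sum>m<M. sqrt_coeff m * P (Suc m)) \<ge> 0\<close> by (simp add: W_def)
qed

subsection \<open>Nearly orthogonal sign vectors\<close>

text \<open>Chernoff bound by counting: the exponential moments at 1 and -1 both equal
  \<open>(exp 1 + exp (-1)) ^ d\<close>, and a bad \<open>y\<close> makes one of the two
  exponentials at least \<open>exp (d / 2)\<close>.\<close>

lemma sign_correlation_count:
  fixes x :: "nat \<Rightarrow> real"
  assumes x: "\<And>l. l < d \<Longrightarrow> x l \<in> {-1, 1}"
  shows "real (card {y \<in> {..<d} \<rightarrow>\<^sub>E {-1, 1}. \<bar>\<Sum>l<d. x l * y l\<bar> > real d / 2})
           \<le> 2 * 2 ^ d * exp (- real d / 25)"
proof -
  define \<Omega> where "\<Omega> = {..<d} \<rightarrow>\<^sub>E {-1, 1::real}"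
  define B where "B = {y \<in> \<Omega>. \<bar>\<Sum>l<d. x l * y l\<bar> > real d / 2}"
  have fin: "finite \<Omega>" by (auto simp: \<Omega>_def intro!: finite_PiE)
  have mgf: "(\<Sum>y\<in>\<Omega>. exp (t * (\<Sum>l<d. x l * y l))) = (exp 1 + exp (-1)) ^ d" if "t \<in> {-1, 1}" for t :: real
  proof -
    have "(\<Sum>y\<in>\<Omega>. exp (t * (\<Sum>l<d. x l * y l))) = (\<Sum>y\<in>\<Omega>. \<Prod>l<d. exp (t * x l * y l))"
      by (simp add: sum_distrib_left exp_sum mult.assoc)
    also have "\<dots> = (\<Prod>l<d. \<Sum>v\<in>{-1, 1}. exp (t * x l * v))"
      unfolding \<Omega>_def by (rule prod_sum_PiE[symmetric]) auto
    \<comment> \<open>Since \<open>t * x l\<close> is 1 or -1, the sum over the two signs does not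
      depend on it.\<close>
    also have "\<dots> = (\<Prod>l<d. exp 1 + exp (-1))"
      using x that by (intro prod.cong refl) fastforce
    finally show ?thesis by simp
  qed
  \<comment> \<open>The rational estimates meet exactly:
    \<open>2.72 + 0.4 = 2 * 1.625 * 0.96\<close>. This fixes the rate 1/25.\<close>
  have e: "exp 1 + exp (-1 :: real) \<le> 2 * exp (1/2) * exp (-1/25)"
  proof -
    have "exp (-1 :: real) \<le> 2 / 5"
      using exp_lower_Taylor_quadratic[of 1] by (simp add: exp_minus field_simps)
    moreover have "exp (1 :: real) \<le> 272 / 100" using e_less_272 by simp
    moreover have "1625 / 1000 \<le> exp (1/2 :: real)"
      using exp_lower_Taylor_quadratic[of "1/2"] by (simp add: power2_eq_square)
    moreover have "1 - 1/25 \<le> exp (-1/25 :: real)"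
      using exp_ge_add_one_self[of "-1/25"] by simp
    then have "1625/1000 * (96/100) \<le> exp (1/2 :: real) * exp (-1/25)"
      using \<open>1625 / 1000 \<le> exp (1/2 :: real)\<close> by (intro mult_mono) auto
    ultimately show ?thesis by simp
  qed
  have "real (card B) * exp (real d / 2) = (\<Sum>y\<in>B. exp (real d / 2))"
    by simp
  also have "\<dots> \<le> (\<Sum>y\<in>B. exp (1 * (\<Sum>l<d. x l * y l)) + exp ((-1) * (\<Sum>l<d. x l * y l)))"
  proof (intro sum_mono)
    fix y assume "y \<in> B"
    then have "real d / 2 \<le> (\<Sum>l<d. x l * y l) \<or> real d / 2 \<le> (-1) * (\<Sum>l<d. x l * y l)"
      by (auto simp: B_def)
    then show "exp (real d / 2) \<le> exp (1 * (\<Sum>l<d. x l * y l)) + exp ((-1) * (\<Sum>l<d. x l * y l))"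
      by (smt (verit) exp_ge_zero exp_le_cancel_iff)
  qed
  also have "\<dots> \<le> (\<Sum>y\<in>\<Omega>. exp (1 * (\<Sum>l<d. x l * y l)) + exp ((-1) * (\<Sum>l<d. x l * y l)))"
    using fin by (intro sum_mono2) (auto simp: B_def intro: add_nonneg_nonneg)
  also have "\<dots> = 2 * (exp 1 + exp (-1)) ^ d"
    unfolding sum.distrib by (subst (1 2) mgf) auto
  also have "\<dots> \<le> 2 * (2 * exp (1/2) * exp (-1/25)) ^ d"
    by (intro mult_left_mono power_mono e) (auto intro: add_nonneg_nonneg)
  also have "\<dots> = (2 * 2 ^ d * exp (- real d / 25)) * exp (real d / 2)"
    by (simp add: power_mult_distrib flip: exp_of_nat_mult)
  finally show ?thesis by (simp add: B_def \<Omega>_def)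
qed

text \<open>Greedy choice: each vector already chosen excludes at most
  \<open>2 * 2 ^ d * exp (- d / 25)\<close> sign vectors, so \<open>k\<close> of them exclude fewer
  than all \<open>2 ^ d\<close> and another choice remains.\<close>

lemma nearly_orthogonal_signs_exist:
  assumes "2 * real k * exp (- real d / 25) < 1"
  shows "\<exists>x :: nat \<Rightarrow> nat \<Rightarrow> real. (\<forall>i\<in>{1..k}. x i \<in> {..<d} \<rightarrow>\<^sub>E {-1, 1}) \<and>
           (\<forall>i\<in>{1..k}. \<forall>j\<in>{1..k}. i \<noteq> j \<longrightarrow> \<bar>\<Sum>l<d. x i l * x j l\<bar> \<le> real d / 2)"
proof -
  define \<Omega> where "\<Omega> = {..<d} \<rightarrow>\<^sub>E {-1, 1::real}"
  have fin: "finite \<Omega>" by (auto simp: \<Omega>_def intro!: finite_PiE)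
  have card: "card \<Omega> = 2 ^ d" by (simp add: \<Omega>_def card_PiE flip: numeral_2_eq_2)
  have "\<exists>x :: nat \<Rightarrow> nat \<Rightarrow> real. (\<forall>i\<in>{1..m}. x i \<in> \<Omega>) \<and>
           (\<forall>i\<in>{1..m}. \<forall>j\<in>{1..m}. i \<noteq> j \<longrightarrow> \<bar>\<Sum>l<d. x i l * x j l\<bar> \<le> real d / 2)" if "m \<le> k" for m
    using that
  proof (induction m)
    case 0
    then show ?case by simp
  next
    case (Suc m)
    then obtain x :: "nat \<Rightarrow> nat \<Rightarrow> real" where x: "\<And>i. i \<in> {1..m} \<Longrightarrow> x i \<in> \<Omega>"
      and orth: "\<And>i j. i \<in> {1..m} \<Longrightarrow> j \<in> {1..m} \<Longrightarrow> i \<noteq> j \<Longrightarrow> \<bar>\<Sum>l<d. x i l * x j l\<bar> \<le> real d / 2"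
      by (metis Suc_leD)
    define B where "B i = {y \<in> \<Omega>. \<bar>\<Sum>l<d. x i l * y l\<bar> > real d / 2}" for i
    have "real (card (\<Union>i\<in>{1..m}. B i)) \<le> (\<Sum>i\<in>{1..m}. real (card (B i)))"
      using card_UN_le[of "{1..m}" B] by (simp flip: of_nat_sum)
    also have "\<dots> \<le> (\<Sum>i\<in>{1..m}. 2 * 2 ^ d * exp (- real d / 25))"
    proof (rule sum_mono)
      fix i assume "i \<in> {1..m}"
      then have "x i l \<in> {-1, 1}" if "l < d" for l
        using x[of i] that by (auto simp: \<Omega>_def PiE_iff)
      then show "real (card (B i)) \<le> 2 * 2 ^ d * exp (- real d / 25)"
        unfolding B_def \<Omega>_def by (rule sign_correlation_count)
    qed
    also have "\<dots> = 2 ^ d * (2 * real m * exp (- real d / 25))" by simp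
    also have "\<dots> \<le> 2 ^ d * (2 * real k * exp (- real d / 25))"
      using Suc.prems by (intro mult_left_mono mult_right_mono) auto
    also have "\<dots> < real (card \<Omega>)"
      using assms by (simp add: card)
    finally have "card (\<Union>i\<in>{1..m}. B i) < card \<Omega>" by simp
    moreover have "finite (\<Union>i\<in>{1..m}. B i)" using fin by (simp add: B_def)
    ultimately have "\<not> \<Omega> \<subseteq> (\<Union>i\<in>{1..m}. B i)"
      using card_mono leD by blast
    then obtain y where y: "y \<in> \<Omega>" "\<And>i. i \<in> {1..m} \<Longrightarrow> \<bar>\<Sum>l<d. x i l * y l\<bar> \<le> real d / 2"
      by (force simp: B_def not_less)
    show ?case
    proof (intro exI[of _ "x(Suc m := y)"] conjI ballI impI)
      fix i assume "i \<in> {1..Suc m}"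
      then show "(x(Suc m := y)) i \<in> \<Omega>"
        using x[of i] y by (cases "i = Suc m") auto
    next
      fix i j assume ij: "i \<in> {1..Suc m}" "j \<in> {1..Suc m}" "i \<noteq> j"
      have "(\<Sum>l<d. y l * x j l) = (\<Sum>l<d. x j l * y l)"
        by (simp add: mult.commute)
      then show "\<bar>\<Sum>l<d. (x(Suc m := y)) i l * (x(Suc m := y)) j l\<bar> \<le> real d / 2"
        using ij y(2)[of i] y(2)[of j] orth[of i j]
        by (cases "i = Suc m"; cases "j = Suc m") auto
    qed
  qed
  then show ?thesis unfolding \<Omega>_def by blast
qed

subsection \<open>Half-space masses control the distance form\<close>

text \<open>\<open>\<bar>s i - s j\<bar>\<close> is the integral over \<open>b\<close> of the
  indicator that \<open>b\<close> separates the two points. For total mass zero the form of that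
  indicator is \<open>2 * (W b)^2\<close>, and \<open>W\<close> vanishes outside
  \<open>{-r..r}\<close>, an interval of length \<open>2 * r\<close>.\<close>

lemma distance_form_abs_le:
  fixes s w :: "'a \<Rightarrow> real"
  assumes I: "finite I" and w: "(\<Sum>i\<in>I. w i) = 0"
    and r: "\<And>i. i \<in> I \<Longrightarrow> \<bar>s i\<bar> \<le> r" "r \<ge> 0"
    and M: "\<And>b. \<bar>\<Sum>i\<in>{i\<in>I. b \<le> s i}. w i\<bar> \<le> M"
  shows "distance_form I (\<lambda>i j. \<bar>s i - s j\<bar>) w \<le> 4 * r * M\<^sup>2"
proof -
  define W where "W b = (\<Sum>i\<in>{i\<in>I. b \<le> s i}. w i)" for b
  \<comment> \<open>Half-open at the lower end, so that \<open>b\<close> lies in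
    \<open>J i j\<close> exactly when one and only one of \<open>b \<le> s i\<close> and
    \<open>b \<le> s j\<close> holds.\<close>
  define J where "J i j = {min (s i) (s j)<..max (s i) (s j)}" for i j
  have len: "has_bochner_integral lborel (indicat_real (J i j)) \<bar>s i - s j\<bar>" for i j
    by (simp add: J_def min_def max_def has_bochner_integral_iff)
  have W_eq: "W b = (\<Sum>i\<in>I. w i * of_bool (b \<le> s i))" for b
    unfolding W_def using I by (simp add: sum.inter_filter if_distrib of_bool_def cong: if_cong)
  have pt: "distance_form I (\<lambda>i j. indicat_real (J i j) b) w = 2 * (W b)\<^sup>2" for b
  proof -
    have ind: "indicat_real (J i j) b = of_bool (b \<le> s i) + of_bool (b \<le> s j) - 2 * (of_bool (b \<le> s i) * of_bool (b \<le> s j))" for i j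
      by (auto simp: J_def indicator_def)
    define u where "u i = w i * of_bool (b \<le> s i)" for i
    have "(\<Sum>i\<in>I. \<Sum>j\<in>I. w i * w j * indicat_real (J i j) b)
        = (\<Sum>i\<in>I. \<Sum>j\<in>I. u i * w j + w i * u j - 2 * (u i * u j))"
      by (simp add: ind u_def algebra_simps)
    also have "\<dots> = sum u I * sum w I + sum w I * sum u I - 2 * (sum u I * sum u I)"
      by (simp only: sum.distrib sum_subtractf sum_distrib_left[symmetric] sum_distrib_right[symmetric])
    finally show ?thesis
      using w by (simp add: distance_form_def W_eq u_def power2_eq_square)
  qed
  have le: "2 * (W b)\<^sup>2 \<le> 2 * M\<^sup>2 * indicat_real {-r..r} b" for b
  proof -
    have "W b = 0" if "b < -r"
    proof -
      have "{i\<in>I. b \<le> s i} = I" using r that by fastforce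
      then show ?thesis using w by (simp add: W_def)
    qed
    moreover have "W b = 0" if "b > r"
    proof -
      have "{i\<in>I. b \<le> s i} = {}" using r that by fastforce
      then show ?thesis unfolding W_def by (simp only: sum.empty)
    qed
    moreover have "(W b)\<^sup>2 \<le> M\<^sup>2"
      using M[of b] unfolding W_def[symmetric] by (metis abs_ge_zero power2_abs power_mono)
    ultimately show ?thesis by (auto simp: indicator_def not_le)
  qed
  have int: "has_bochner_integral lborel (\<lambda>b. distance_form I (\<lambda>i j. indicat_real (J i j) b) w)
      (distance_form I (\<lambda>i j. \<bar>s i - s j\<bar>) w)"
    unfolding distance_form_def
    by (intro has_bochner_integral_minus has_bochner_integral_sum has_bochner_integral_mult_right len)
  then have "distance_form I (\<lambda>i j. \<bar>s i - s j\<bar>) w = (LBINT b. distance_form I (\<lambda>i j. indicat_real (J i j) b) w)"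
    by (simp add: has_bochner_integral_iff)
  also have "\<dots> \<le> (LBINT b. 2 * M\<^sup>2 * indicat_real {-r..r} b)"
  proof (intro integral_mono)
    show "integrable lborel (\<lambda>b. 2 * M\<^sup>2 * indicat_real {-r..r} b)"
      using r by (intro integrable_mult_right integrable_real_indicator) auto
  qed (use int in \<open>auto simp: has_bochner_integral_iff pt le\<close>)
  also have "\<dots> = 4 * r * M\<^sup>2" using r by simp
  finally show ?thesis .
qed


section \<open>Standard Gaussian vectors and random projections\<close>

definition gaussian_vec :: "nat \<Rightarrow> (nat \<Rightarrow> real) measure" where
  "gaussian_vec d = (\<Pi>\<^sub>M l\<in>{..<d}. density lborel std_normal_density)"

lemma prob_space_gaussian_vec: "prob_space (gaussian_vec d)"
  unfolding gaussian_vec_def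
  by (intro prob_space_PiM prob_space_normal_density) simp

lemma gaussian_vec_coordinate_distributed:
  assumes "l < d"
  shows "distributed (gaussian_vec d) lborel (\<lambda>v. v l) std_normal_density"
proof -
  have "distr (gaussian_vec d) (density lborel std_normal_density) (\<lambda>v. v l) = density lborel std_normal_density"
    unfolding gaussian_vec_def
    using assms by (intro distr_PiM_component[of "{..<d}" "\<lambda>_. density lborel std_normal_density"]
        prob_space_normal_density) auto
  moreover have "distr (gaussian_vec d) (density lborel std_normal_density) (\<lambda>v. v l)
      = distr (gaussian_vec d) lborel (\<lambda>v. v l)"
    by (intro distr_cong) auto
  moreover have "(\<lambda>v. v l) \<in> measurable (gaussian_vec d) lborel"
    unfolding gaussian_vec_def
    using measurable_component_singleton[of l "{..<d}" "\<lambda>_. density lborel std_normal_density"] assms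
    by (simp cong: measurable_cong_sets)
  ultimately show ?thesis
    by (simp add: distributed_def)
qed

lemma gaussian_vec_indep:
  assumes "d > 0"
  shows "prob_space.indep_vars (gaussian_vec d) (\<lambda>_. borel) (\<lambda>l v. v l) {..<d}"
proof -
  interpret prob_space "gaussian_vec d" by (rule prob_space_gaussian_vec)
  let ?N = "density lborel std_normal_density"
  have comp: "(\<lambda>v. v l) \<in> borel_measurable (gaussian_vec d)" if "l < d" for l
    using gaussian_vec_coordinate_distributed[OF that] by (simp add: distributed_def)
  \<comment> \<open>Restriction to \<open>{..<d}\<close> is the identity on the extensional
    functions of the product space, so the joint law is the product of the marginals.\<close>
  have "distr (gaussian_vec d) (\<Pi>\<^sub>M l\<in>{..<d}. borel) (\<lambda>v. \<lambda>l\<in>{..<d}. v l) = gaussian_vec d"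
  proof -
    have "distr (gaussian_vec d) (\<Pi>\<^sub>M l\<in>{..<d}. borel) (\<lambda>v. \<lambda>l\<in>{..<d}. v l)
        = distr (gaussian_vec d) (gaussian_vec d) (\<lambda>v. v)"
      by (intro distr_cong) (auto simp: gaussian_vec_def space_PiM intro!: sets_PiM_cong)
    then show ?thesis by simp
  qed
  also have "gaussian_vec d = (\<Pi>\<^sub>M l\<in>{..<d}. distr (gaussian_vec d) borel (\<lambda>v. v l))"
  proof -
    have "distr (gaussian_vec d) borel (\<lambda>v. v l) = ?N" if "l < d" for l
      using gaussian_vec_coordinate_distributed[OF that]
      by (simp add: distributed_def cong: distr_cong)
    then show ?thesis
      unfolding gaussian_vec_def by (intro PiM_cong) auto
  qed
  finally show ?thesis
    using assms comp by (subst indep_vars_iff_distr_eq_PiM') auto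
qed

lemma gaussian_vec_square:
  assumes "l < d"
  shows "has_bochner_integral (gaussian_vec d) (\<lambda>v. (v l)\<^sup>2) 1"
proof -
  note D = gaussian_vec_coordinate_distributed[OF assms]
  have "integrable lborel (\<lambda>x. std_normal_density x * x\<^sup>2)"
    using integrable_std_normal_moment[of 2] by simp
  then have "integrable (gaussian_vec d) (\<lambda>v. (v l)\<^sup>2)"
    using distributed_integrable[OF D, of "\<lambda>x. x\<^sup>2"] by simp
  moreover have "(\<integral>v. (v l)\<^sup>2 \<partial>gaussian_vec d) = 1"
    using distributed_integral[OF D, of "\<lambda>x. x\<^sup>2"] integral_std_normal_moment_even[of 1] by simp
  ultimately show ?thesis by (simp add: has_bochner_integral_iff)
qed

text \<open>The inner product is centred normal with variance the squared norm of \<open>z\<close>;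
  a normal variable of deviation \<open>\<sigma>\<close> has mean absolute value
  \<open>sqrt (2 / pi) * \<sigma>\<close>.\<close>

lemma gaussian_vec_abs_inner:
  "has_bochner_integral (gaussian_vec d) (\<lambda>v. \<bar>\<Sum>l<d. z l * v l\<bar>) (sqrt (2 / pi) * sqrt (\<Sum>l<d. (z l)\<^sup>2))"
proof -
  interpret prob_space "gaussian_vec d" by (rule prob_space_gaussian_vec)
  \<comment> \<open>Zero coordinates are removed because a normal density needs positive
    deviation.\<close>
  define L where "L = {l\<in>{..<d}. z l \<noteq> 0}"
  have sumL: "(\<Sum>l<d. z l * v l) = (\<Sum>l\<in>L. z l * v l)" for v
    by (rule sum.mono_neutral_right) (auto simp: L_def)
  have sqL: "(\<Sum>l<d. (z l)\<^sup>2) = (\<Sum>l\<in>L. \<bar>z l\<bar>\<^sup>2)"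
    by (simp, rule sum.mono_neutral_right) (auto simp: L_def)
  show ?thesis
  proof (cases "L = {}")
    case True
    then show ?thesis by (simp add: sumL sqL has_bochner_integral_zero del: power2_abs)
  next
    case False
    then have d: "d > 0" by (auto simp: L_def)
    have "indep_vars (\<lambda>_. borel) (\<lambda>l v. z l * v l) L"
      using indep_vars_subset[OF gaussian_vec_indep[OF d], of L]
      by (rule indep_vars_compose2) (auto simp: L_def)
    moreover have "distributed (gaussian_vec d) lborel (\<lambda>v. z l * v l) (normal_density 0 \<bar>z l\<bar>)" if "l \<in> L" for l
      using normal_density_affine[OF gaussian_vec_coordinate_distributed[of l d], of "z l" 0] that
      by (simp add: L_def)
    ultimately have "distributed (gaussian_vec d) lborel (\<lambda>v. \<Sum>l\<in>L. z l * v l)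
        (normal_density (\<Sum>l\<in>L. 0) (sqrt (\<Sum>l\<in>L. \<bar>z l\<bar>\<^sup>2)))"
      using False by (intro sum_indep_normal) (auto simp: L_def)
    then have D: "distributed (gaussian_vec d) lborel (\<lambda>v. \<Sum>l\<in>L. z l * v l)
        (normal_density 0 (sqrt (\<Sum>l\<in>L. \<bar>z l\<bar>\<^sup>2)))"
      by simp
    define \<sigma> where "\<sigma> = sqrt (\<Sum>l\<in>L. \<bar>z l\<bar>\<^sup>2)"
    have "\<sigma> > 0"
      unfolding \<sigma>_def using False by (intro real_sqrt_gt_zero sum_pos) (auto simp: L_def)
    have "integrable lborel (\<lambda>x. normal_density 0 \<sigma> x * \<bar>x\<bar>)"
      using integrable_normal_moment_abs[of \<sigma> 0 1] \<open>\<sigma> > 0\<close> by simp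
    then have "integrable (gaussian_vec d) (\<lambda>v. \<bar>\<Sum>l\<in>L. z l * v l\<bar>)"
      using distributed_integrable[OF D[folded \<sigma>_def], of abs] by simp
    moreover have "(\<integral>v. \<bar>\<Sum>l\<in>L. z l * v l\<bar> \<partial>gaussian_vec d) = sqrt (2 / pi) * \<sigma>"
      using distributed_integral[OF D[folded \<sigma>_def], of abs] integral_normal_moment_abs_odd[of \<sigma> 0 0] \<open>\<sigma> > 0\<close>
      by (simp add: mult.commute)
    ultimately show ?thesis
      unfolding sumL sqL \<sigma>_def[symmetric] by (simp add: has_bochner_integral_iff)
  qed
qed

text \<open>The one-dimensional bound is applied along every Gaussian direction \<open>v\<close>
  with radius \<open>r v\<close>, and then averaged. Projected distances average to Euclidean ones
  times \<open>sqrt (2 / pi)\<close>.\<close>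

lemma distance_form_halfspace_le:
  fixes x :: "'a \<Rightarrow> nat \<Rightarrow> real"
  assumes I: "finite I" and w: "(\<Sum>i\<in>I. w i) = 0" and d: "d > 0"
    and x: "\<And>i. i \<in> I \<Longrightarrow> (\<Sum>l<d. (x i l)\<^sup>2) \<le> 1"
    and M: "\<And>v b. \<bar>\<Sum>i\<in>{i\<in>I. b \<le> (\<Sum>l<d. x i l * v l)}. w i\<bar> \<le> M"
  shows "distance_form I (\<lambda>i j. sqrt (\<Sum>l<d. (x i l - x j l)\<^sup>2)) w \<le> 6 * sqrt (real d) * M\<^sup>2"
proof -
  define s where "s v i = (\<Sum>l<d. x i l * v l)" for v i
  define r where "r v = ((\<Sum>l<d. (v l)\<^sup>2) / sqrt (real d) + sqrt (real d)) / 2" for v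
  define F where "F v = distance_form I (\<lambda>i j. \<bar>s v i - s v j\<bar>) w" for v
  interpret prob_space "gaussian_vec d" by (rule prob_space_gaussian_vec)
  have int: "has_bochner_integral (gaussian_vec d) (\<lambda>v. \<bar>s v i - s v j\<bar>)
       (sqrt (2 / pi) * sqrt (\<Sum>l<d. (x i l - x j l)\<^sup>2))" for i j
    using gaussian_vec_abs_inner[of d "\<lambda>l. x i l - x j l"]
    by (simp add: s_def left_diff_distrib sum_subtractf)
  have F: "has_bochner_integral (gaussian_vec d) F
      (distance_form I (\<lambda>i j. sqrt (2 / pi) * sqrt (\<Sum>l<d. (x i l - x j l)\<^sup>2)) w)"
    unfolding F_def distance_form_def
    by (intro has_bochner_integral_minus has_bochner_integral_sum has_bochner_integral_mult_right int)
  have "has_bochner_integral (gaussian_vec d) r (((\<Sum>l<d. 1) / sqrt (real d) + sqrt (real d)) / 2)"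
    unfolding r_def
    by (intro has_bochner_integral_divide has_bochner_integral_add has_bochner_integral_sum
        gaussian_vec_square) (auto simp: has_bochner_integral_iff prob_space)
  then have r: "has_bochner_integral (gaussian_vec d) r (sqrt (real d))"
    using d by (simp add: real_div_sqrt)
  \<comment> \<open>\<open>r\<close> bounds the Euclidean norm by AM-GM, and its mean is explicit.\<close>
  have r_bound: "\<bar>s v i\<bar> \<le> r v" if "i \<in> I" for v i
  proof -
    define V where "V = (\<Sum>l<d. (v l)\<^sup>2)"
    have V: "V \<ge> 0" by (simp add: V_def sum_nonneg)
    have "(s v i)\<^sup>2 \<le> (\<Sum>l<d. (x i l)\<^sup>2) * V"
      unfolding s_def V_def by (rule Cauchy_Schwarz_ineq_sum)
    also have "\<dots> \<le> V" using mult_right_mono[OF x[OF that] V] by simp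
    also have "V \<le> (r v)\<^sup>2"
    proof -
      have "((V / q + q) / 2)\<^sup>2 - V = ((V / q - q) / 2)\<^sup>2" if "q > 0" for q :: real
        using that by (simp add: power2_eq_square field_simps)
      then have "(r v)\<^sup>2 - V = ((V / sqrt (real d) - sqrt (real d)) / 2)\<^sup>2"
        using d by (simp add: r_def V_def)
      then show ?thesis by (metis diff_ge_0_iff_ge zero_le_power2)
    qed
    finally have "\<bar>s v i\<bar> \<le> \<bar>r v\<bar>" by (simp add: abs_le_square_iff)
    moreover have "r v \<ge> 0" using V by (simp add: r_def V_def)
    ultimately show ?thesis by simp
  qed
  have "F v \<le> 4 * r v * M\<^sup>2" for v
    unfolding F_def
  proof (rule distance_form_abs_le[OF I w r_bound])
    show "r v \<ge> 0" by (auto simp: r_def intro!: add_nonneg_nonneg divide_nonneg_nonneg sum_nonneg)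
    show "\<bar>\<Sum>i\<in>{i\<in>I. b \<le> s v i}. w i\<bar> \<le> M" for b
      using M by (simp add: s_def)
  qed
  then have "(\<integral>v. F v \<partial>gaussian_vec d) \<le> (\<integral>v. 4 * r v * M\<^sup>2 \<partial>gaussian_vec d)"
    using F r by (intro integral_mono) (auto simp: has_bochner_integral_iff)
  also have "\<dots> = 4 * sqrt (real d) * M\<^sup>2"
    using r by (simp add: has_bochner_integral_iff)
  finally have "sqrt (2 / pi) * distance_form I (\<lambda>i j. sqrt (\<Sum>l<d. (x i l - x j l)\<^sup>2)) w
      \<le> 4 * sqrt (real d) * M\<^sup>2"
    using F by (simp add: has_bochner_integral_iff distance_form_scale)
  then have "sqrt (pi / 2) * (sqrt (2 / pi) * distance_form I (\<lambda>i j. sqrt (\<Sum>l<d. (x i l - x j l)\<^sup>2)) w)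
      \<le> sqrt (pi / 2) * (4 * sqrt (real d) * M\<^sup>2)"
    by (intro mult_left_mono) auto
  \<comment> \<open>The constant 6 arises as \<open>3 / 2 * 4\<close>.\<close>
  also have "\<dots> \<le> (3 / 2) * (4 * sqrt (real d) * M\<^sup>2)"
  proof (intro mult_right_mono real_le_lsqrt)
    show "pi / 2 \<le> (3 / 2)\<^sup>2" using pi_less_4 by (simp add: power2_eq_square)
  qed auto
  also have "sqrt (pi / 2) * (sqrt (2 / pi) * y) = y" for y
    by (simp add: real_sqrt_divide)
  finally show ?thesis by simp
qed

subsection \<open>Discrepancies of finitely supported distributions\<close>

lemma finite_samples: "finite (samples k n)"
  by (simp add: samples_def finite_PiE)

lemma empirical_eq_map: "empirical a n X = map_pmf a (map_pmf X (pmf_of_set {1..n}))"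
  by (simp add: empirical_def map_pmf_comp)

lemma prob_dists_sum_eq_1: "\<mu> \<in> prob_dists k \<Longrightarrow> (\<Sum>i\<in>{1..k}. pmf \<mu> i) = 1"
  by (intro sum_pmf_eq_1) (auto simp: prob_dists_def)

lemma prob_dists_finite_support: "\<mu> \<in> prob_dists k \<Longrightarrow> finite (set_pmf \<mu>)"
  by (auto simp: prob_dists_def intro: finite_subset)

lemma expectation_prob_dists:
  fixes f :: "nat \<Rightarrow> real"
  assumes "\<mu> \<in> prob_dists k"
  shows "measure_pmf.expectation \<mu> f = (\<Sum>i\<in>{1..k}. pmf \<mu> i * f i)"
  using assms by (subst integral_measure_pmf_real[where A = "{1..k}"])
    (auto simp: prob_dists_def mult.commute)

lemma prob_prob_dists:
  assumes "\<mu> \<in> prob_dists k"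
  shows "measure_pmf.prob \<mu> A = (\<Sum>i\<in>{i\<in>{1..k}. i \<in> A}. pmf \<mu> i)"
proof -
  have "measure_pmf.prob \<mu> A = measure_pmf.prob \<mu> {i\<in>{1..k}. i \<in> A}"
    using assms by (intro measure_pmf.finite_measure_eq_AE) (auto simp: AE_measure_pmf_iff prob_dists_def)
  then show ?thesis by (simp add: measure_measure_pmf_finite)
qed

lemma empirical_in_prob_dists:
  assumes "X \<in> samples k n" "n \<ge> 1"
  shows "map_pmf X (pmf_of_set {1..n}) \<in> prob_dists k"
  using assms by (auto simp: samples_def prob_dists_def)

lemma pmf_empirical:
  assumes "n \<ge> 1"
  shows "pmf (map_pmf X (pmf_of_set {1..n})) i = (\<Sum>l\<in>{1..n}. of_bool (X l = i)) / real n"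
  using assms by (simp add: pmf_map measure_pmf_of_set of_bool_def sum.If_cases vimage_def Int_def)

lemma set_iid_sample:
  assumes "\<nu> \<in> prob_dists k"
  shows "set_pmf (iid_sample n \<nu>) \<subseteq> samples k n"
  using assms by (auto simp: iid_sample_def set_Pi_pmf samples_def prob_dists_def PiE_dflt_def PiE_iff extensional_def)

lemma integral_pair_pmf_finite:
  fixes f :: "'a \<times> 'b \<Rightarrow> real"
  assumes "finite (set_pmf p)" "finite (set_pmf q)"
  shows "measure_pmf.expectation (pair_pmf p q) f
       = measure_pmf.expectation p (\<lambda>x. measure_pmf.expectation q (\<lambda>y. f (x, y)))"
proof -
  have "measure_pmf.expectation (pair_pmf p q) f = (\<Sum>z\<in>set_pmf p \<times> set_pmf q. f z * pmf (pair_pmf p q) z)"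
    using assms by (intro integral_measure_pmf_real) auto
  also have "\<dots> = (\<Sum>x\<in>set_pmf p. \<Sum>y\<in>set_pmf q. f (x, y) * (pmf p x * pmf q y))"
    by (simp add: sum.cartesian_product pmf_pair case_prod_unfold flip: pmf_pair)
  also have "\<dots> = measure_pmf.expectation p (\<lambda>x. measure_pmf.expectation q (\<lambda>y. f (x, y)))"
    using assms by (simp add: integral_measure_pmf_real[of "set_pmf p"] integral_measure_pmf_real[of "set_pmf q"]
        sum_distrib_left sum_distrib_right mult_ac)
  finally show ?thesis .
qed

text \<open>The four independent draws are pulled back to indices and integrated in turn. Symmetry
  of the distance splits the doubled cross term into its two orders, which completes the product of
  differences.\<close>

lemma energy_dist_sq_eq_distance_form:
  assumes \<mu>: "\<mu> \<in> prob_dists k" and \<nu>: "\<nu> \<in> prob_dists k"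
    and a: "\<And>i. i \<in> {1..k} \<Longrightarrow> a i \<in> carrier_vec d"
  shows "energy_dist_sq (map_pmf a \<mu>) (map_pmf a \<nu>)
       = distance_form {1..k} (\<lambda>i j. eucl_norm (a i - a j)) (\<lambda>i. pmf \<mu> i - pmf \<nu> i)"
proof -
  define D where "D i j = eucl_norm (a i - a j)" for i j
  note fin = prob_dists_finite_support[OF \<mu>] prob_dists_finite_support[OF \<nu>]
  have int: "integrable (measure_pmf \<mu>) g" "integrable (measure_pmf \<nu>) g" for g :: "nat \<Rightarrow> real"
    using fin by (auto intro: integrable_measure_pmf_finite)
  have sym: "D i j = D j i" if "i \<in> {1..k}" "j \<in> {1..k}" for i j
  proof -
    have "a i - a j = - (a j - a i)"
      using a[OF that(1)] a[OF that(2)] by auto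
    then show ?thesis
      using a[OF that(1)] a[OF that(2)] by (simp add: D_def eucl_norm_def)
  qed
  have "energy_dist_sq (map_pmf a \<mu>) (map_pmf a \<nu>)
      = measure_pmf.expectation (pair_pmf \<mu> (pair_pmf \<mu> (pair_pmf \<nu> \<nu>)))
          (\<lambda>(i, i', j, j'). 2 * D i j - D i i' - D j j')"
    unfolding energy_dist_sq_def
    by (simp add: D_def case_prod_unfold flip: map_pair)
  also have "\<dots> = measure_pmf.expectation \<mu> (\<lambda>i. measure_pmf.expectation \<mu> (\<lambda>i'.
        measure_pmf.expectation \<nu> (\<lambda>j. measure_pmf.expectation \<nu> (\<lambda>j'. 2 * D i j - D i i' - D j j'))))"
    using fin by (simp add: integral_pair_pmf_finite)
  also have "\<dots> = 2 * measure_pmf.expectation \<mu> (\<lambda>i. measure_pmf.expectation \<nu> (\<lambda>j. D i j))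
       - measure_pmf.expectation \<mu> (\<lambda>i. measure_pmf.expectation \<mu> (\<lambda>j. D i j))
       - measure_pmf.expectation \<nu> (\<lambda>i. measure_pmf.expectation \<nu> (\<lambda>j. D i j))"
    by (simp add: int)
  also have "\<dots> = 2 * (\<Sum>i\<in>{1..k}. \<Sum>j\<in>{1..k}. pmf \<mu> i * pmf \<nu> j * D i j)
       - (\<Sum>i\<in>{1..k}. \<Sum>j\<in>{1..k}. pmf \<mu> i * pmf \<mu> j * D i j)
       - (\<Sum>i\<in>{1..k}. \<Sum>j\<in>{1..k}. pmf \<nu> i * pmf \<nu> j * D i j)"
    by (simp add: expectation_prob_dists[OF \<mu>] expectation_prob_dists[OF \<nu>] sum_distrib_left mult_ac)
  also have "(\<Sum>i\<in>{1..k}. \<Sum>j\<in>{1..k}. pmf \<mu> i * pmf \<nu> j * D i j)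
      = (\<Sum>i\<in>{1..k}. \<Sum>j\<in>{1..k}. pmf \<mu> j * pmf \<nu> i * D i j)"
    by (subst sum.swap) (auto intro!: sum.cong simp: sym)
  then have "2 * (\<Sum>i\<in>{1..k}. \<Sum>j\<in>{1..k}. pmf \<mu> i * pmf \<nu> j * D i j)
      = (\<Sum>i\<in>{1..k}. \<Sum>j\<in>{1..k}. pmf \<mu> i * pmf \<nu> j * D i j)
        + (\<Sum>i\<in>{1..k}. \<Sum>j\<in>{1..k}. pmf \<mu> j * pmf \<nu> i * D i j)"
    by simp
  also have "(\<Sum>i\<in>{1..k}. \<Sum>j\<in>{1..k}. pmf \<mu> i * pmf \<nu> j * D i j)
        + (\<Sum>i\<in>{1..k}. \<Sum>j\<in>{1..k}. pmf \<mu> j * pmf \<nu> i * D i j)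
       - (\<Sum>i\<in>{1..k}. \<Sum>j\<in>{1..k}. pmf \<mu> i * pmf \<mu> j * D i j)
       - (\<Sum>i\<in>{1..k}. \<Sum>j\<in>{1..k}. pmf \<nu> i * pmf \<nu> j * D i j)
      = distance_form {1..k} D (\<lambda>i. pmf \<mu> i - pmf \<nu> i)"
    unfolding distance_form_def
    by (simp add: algebra_simps flip: sum.distrib sum_subtractf sum_negf)
  finally show ?thesis by (simp add: D_def[abs_def])
qed

lemma halfspace_dist_ge:
  assumes \<mu>: "\<mu> \<in> prob_dists k" and \<nu>: "\<nu> \<in> prob_dists k"
    and a: "\<And>i. i \<in> {1..k} \<Longrightarrow> a i \<in> carrier_vec d" and v: "v \<in> carrier_vec d"
  shows "\<bar>\<Sum>i\<in>{i\<in>{1..k}. b \<le> scalar_prod (a i) v}. pmf \<mu> i - pmf \<nu> i\<bar>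
     \<le> halfspace_dist d (map_pmf a \<mu>) (map_pmf a \<nu>)"
proof -
  define w where "w i = pmf \<mu> i - pmf \<nu> i" for i
  define h where "h v b = (\<Sum>i\<in>{i\<in>{1..k}. b \<le> scalar_prod (a i) v}. w i)" for v b
  define H where "H p v b = measure_pmf.prob p {x \<in> carrier_vec d. scalar_prod x v \<ge> b}" for p :: "real vec pmf" and v b
  have upper: "h v b \<le> halfspace_dist d (map_pmf a \<mu>) (map_pmf a \<nu>)" if "v \<in> carrier_vec d" for v b
  proof -
    have "H (map_pmf a p) v b = (\<Sum>i\<in>{i\<in>{1..k}. b \<le> scalar_prod (a i) v}. pmf p i)"
      if "p \<in> prob_dists k" for p
      unfolding H_def measure_map_pmf
      by (subst prob_prob_dists[OF that], intro sum.cong) (use a in auto)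
    then have "h v b = H (map_pmf a \<mu>) v b - H (map_pmf a \<nu>) v b"
      using \<mu> \<nu> by (simp add: h_def w_def sum_subtractf)
    also have "\<dots> \<le> (SUP (v, b) \<in> carrier_vec d \<times> (UNIV :: real set). H (map_pmf a \<mu>) v b - H (map_pmf a \<nu>) v b)"
    proof -
      have "H (map_pmf a \<mu>) v b - H (map_pmf a \<nu>) v b \<le> 1" for v b
        unfolding H_def by (smt (verit) measure_nonneg measure_pmf.prob_le_1)
      then have "bdd_above ((\<lambda>(v, b). H (map_pmf a \<mu>) v b - H (map_pmf a \<nu>) v b) ` (carrier_vec d \<times> (UNIV :: real set)))"
        by (intro bdd_aboveI2[where M = 1]) auto
      from cSUP_upper[OF _ this, of "(v, b)"] show ?thesis
        using that by simp
    qed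
    finally show ?thesis
      by (simp add: halfspace_dist_def H_def)
  qed
  \<comment> \<open>The complement of a closed half-space is open, but it meets the finitely many points in a
    closed half-space; the total mass of \<open>w\<close> is zero.\<close>
  define b' where "b' = Max (insert (b - 1) {scalar_prod (a i) v | i. i \<in> {1..k} \<and> scalar_prod (a i) v < b})"
  have fin: "finite (insert (b - 1) {scalar_prod (a i) v | i. i \<in> {1..k} \<and> scalar_prod (a i) v < b})"
    by simp
  \<comment> \<open>The entry \<open>b - 1\<close> covers the case in which every point already lies
    in the half-space.\<close>
  have "b' < b"
    unfolding b'_def using fin by (subst Max_less_iff) auto
  have b': "scalar_prod (a i) v \<le> b'" if "i \<in> {1..k}" "scalar_prod (a i) v < b" for i
    unfolding b'_def using fin that by (intro Max_ge) auto
  have set_eq: "{i\<in>{1..k}. - b' \<le> scalar_prod (a i) (- v)} = {1..k} - {i\<in>{1..k}. b \<le> scalar_prod (a i) v}"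
    using b' \<open>b' < b\<close> a v by fastforce
  have "h (- v) (- b') = - h v b"
  proof -
    have "h (- v) (- b') = sum w {1..k} - h v b"
      unfolding h_def set_eq by (subst sum_diff) auto
    also have "sum w {1..k} = 0"
      using prob_dists_sum_eq_1[OF \<mu>] prob_dists_sum_eq_1[OF \<nu>] by (simp add: w_def sum_subtractf)
    finally show ?thesis by simp
  qed
  then show ?thesis
    using upper[OF v, of b] upper[of "- v" "- b'"] v by (simp add: h_def w_def)
qed

lemma tv_dist_nonneg: "0 \<le> tv_dist \<mu> \<nu>"
  and tv_dist_le_1: "tv_dist \<mu> \<nu> \<le> 1"
proof -
  have le: "measure_pmf.prob \<mu> A - measure_pmf.prob \<nu> A \<le> 1" for A
    by (smt (verit) measure_nonneg measure_pmf.prob_le_1)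
  then show "tv_dist \<mu> \<nu> \<le> 1"
    unfolding tv_dist_def by (intro cSUP_least) auto
  have "bdd_above (range (\<lambda>A. measure_pmf.prob \<mu> A - measure_pmf.prob \<nu> A))"
    using le by (intro bdd_aboveI2[where M = 1]) auto
  from cSUP_upper[OF _ this, of "{}"] show "0 \<le> tv_dist \<mu> \<nu>"
    by (simp add: tv_dist_def)
qed

text \<open>Total variation is bounded by the l1 distance, then Cauchy-Schwarz over the
  \<open>k\<close> letters applies.\<close>

lemma tv_dist_square_le:
  assumes \<mu>: "\<mu> \<in> prob_dists k" and \<nu>: "\<nu> \<in> prob_dists k"
  shows "(tv_dist \<mu> \<nu>)\<^sup>2 \<le> real k * (\<Sum>i\<in>{1..k}. (pmf \<mu> i - pmf \<nu> i)\<^sup>2)"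
proof -
  have "tv_dist \<mu> \<nu> \<le> (\<Sum>i\<in>{1..k}. \<bar>pmf \<mu> i - pmf \<nu> i\<bar>)"
    unfolding tv_dist_def
  proof (intro cSUP_least)
    fix A
    have "measure_pmf.prob \<mu> A - measure_pmf.prob \<nu> A = (\<Sum>i\<in>{i\<in>{1..k}. i \<in> A}. pmf \<mu> i - pmf \<nu> i)"
      by (simp only: prob_prob_dists[OF \<mu>] prob_prob_dists[OF \<nu>] sum_subtractf)
    also have "\<dots> \<le> (\<Sum>i\<in>{i\<in>{1..k}. i \<in> A}. \<bar>pmf \<mu> i - pmf \<nu> i\<bar>)"
      by (intro sum_mono) auto
    also have "\<dots> \<le> (\<Sum>i\<in>{1..k}. \<bar>pmf \<mu> i - pmf \<nu> i\<bar>)"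
      by (intro sum_mono2) auto
    finally show "measure_pmf.prob \<mu> A - measure_pmf.prob \<nu> A \<le> (\<Sum>i\<in>{1..k}. \<bar>pmf \<mu> i - pmf \<nu> i\<bar>)" .
  qed simp
  then have "(tv_dist \<mu> \<nu>)\<^sup>2 \<le> (\<Sum>i\<in>{1..k}. 1 * \<bar>pmf \<mu> i - pmf \<nu> i\<bar>)\<^sup>2"
    by (intro power_mono) (auto simp: tv_dist_nonneg)
  also have "\<dots> \<le> (\<Sum>i\<in>{1..k}. 1\<^sup>2) * (\<Sum>i\<in>{1..k}. \<bar>pmf \<mu> i - pmf \<nu> i\<bar>\<^sup>2)"
    by (rule Cauchy_Schwarz_ineq_sum)
  finally show ?thesis by simp
qed

subsection \<open>Risk bounds\<close>

lemma iid_sample_covariance: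
  assumes \<nu>: "\<nu> \<in> prob_dists k" and l: "l \<in> {1..n}" and m: "m \<in> {1..n}"
  shows "measure_pmf.expectation (iid_sample n \<nu>)
            (\<lambda>X. (of_bool (X l = i) - pmf \<nu> i) * (of_bool (X m = j) - pmf \<nu> j))
       = (if l = m then of_bool (i = j) * pmf \<nu> i - pmf \<nu> i * pmf \<nu> j else 0)"
proof -
  define g where "g i x = of_bool (x = i) - pmf \<nu> i" for i x :: nat
  have fin: "finite (set_pmf \<nu>)" by (rule prob_dists_finite_support[OF \<nu>])
  have finX: "finite (set_pmf (iid_sample n \<nu>))"
    using set_iid_sample[OF \<nu>] finite_samples by (rule finite_subset)
  have int: "integrable (measure_pmf \<nu>) f" for f :: "nat \<Rightarrow> real"
    using fin by (rule integrable_measure_pmf_finite)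
  have ind: "measure_pmf.expectation \<nu> (\<lambda>x. of_bool (x = i)) = pmf \<nu> i" for i
  proof -
    have "(\<lambda>x. of_bool (x = i)) = indicat_real {i}" by (auto simp: indicator_def)
    then show ?thesis by (simp add: measure_pmf_single)
  qed
  have comp: "measure_pmf.expectation (iid_sample n \<nu>) (\<lambda>X. f (X l)) = measure_pmf.expectation \<nu> f"
    if "l \<in> {1..n}" for l and f :: "nat \<Rightarrow> real"
  proof -
    have "\<nu> = map_pmf (\<lambda>X. X l) (iid_sample n \<nu>)"
      using that unfolding iid_sample_def by (subst Pi_pmf_component) auto
    then have "measure_pmf.expectation \<nu> f = measure_pmf.expectation (map_pmf (\<lambda>X. X l) (iid_sample n \<nu>)) f"
      by simp
    then show ?thesis by simp
  qed
  show ?thesis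
  proof (cases "l = m")
    case True
    have "(\<lambda>x. g i x * g j x) = (\<lambda>x. of_bool (i = j) * of_bool (x = i)
        - pmf \<nu> j * of_bool (x = i) - pmf \<nu> i * of_bool (x = j) + pmf \<nu> i * pmf \<nu> j)"
      by (auto simp: g_def fun_eq_iff algebra_simps)
    then have "measure_pmf.expectation \<nu> (\<lambda>x. g i x * g j x) = of_bool (i = j) * pmf \<nu> i - pmf \<nu> i * pmf \<nu> j"
      by (simp add: int ind)
    then show ?thesis
      using True comp[OF l, of "\<lambda>x. g i x * g j x"] by (simp add: g_def)
  next
    case False
    note P = measure_pmf.prob_space_axioms[of "iid_sample n \<nu>"]
    \<comment> \<open>A single family carries \<open>g i\<close> at position \<open>l\<close> and
      \<open>g j\<close> elsewhere, so that independence of the coordinates yields the product rule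
      for the pair.\<close>
    define Y where "Y r X = (if r = l then g i (X r) else g j (X r))" for r and X :: "nat \<Rightarrow> nat"
    have "prob_space.indep_vars (iid_sample n \<nu>) (\<lambda>_. count_space UNIV) (\<lambda>x f. f x) {1..n}"
      unfolding iid_sample_def by (rule indep_vars_Pi_pmf) simp
    then have "prob_space.indep_vars (iid_sample n \<nu>) (\<lambda>_. borel) (\<lambda>r X. (if r = l then g i else g j) (X r)) {1..n}"
      by (rule prob_space.indep_vars_compose2[OF P]) simp
    then have "prob_space.indep_vars (iid_sample n \<nu>) (\<lambda>_. borel) Y {1..n}"
      unfolding Y_def by (simp add: if_distribR cong: if_cong)
    then have "prob_space.indep_vars (iid_sample n \<nu>) (\<lambda>_. borel) Y {l, m}"
      by (rule prob_space.indep_vars_subset[OF P]) (use l m in auto)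
    then have "measure_pmf.expectation (iid_sample n \<nu>) (\<lambda>X. \<Prod>r\<in>{l, m}. Y r X)
        = (\<Prod>r\<in>{l, m}. measure_pmf.expectation (iid_sample n \<nu>) (Y r))"
      using finX by (intro prob_space.indep_vars_lebesgue_integral[OF P]) (auto intro: integrable_measure_pmf_finite)
    also have "\<dots> = measure_pmf.expectation (iid_sample n \<nu>) (\<lambda>X. g i (X l)) * measure_pmf.expectation (iid_sample n \<nu>) (Y m)"
      using False by (simp add: Y_def[abs_def])
    also have "measure_pmf.expectation (iid_sample n \<nu>) (\<lambda>X. g i (X l)) = 0"
      using comp[OF l, of "g i"] by (simp add: g_def[abs_def] int ind)
    finally show ?thesis
      using False by (simp add: Y_def[abs_def] g_def)
  qed
qed

text \<open>Of the \<open>n * n\<close> pairs of positions only the \<open>n\<close> equal ones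
  contribute, which leaves the one-letter covariance divided by \<open>n\<close>.\<close>

lemma empirical_covariance:
  assumes \<nu>: "\<nu> \<in> prob_dists k" and n: "n \<ge> 1"
  shows "measure_pmf.expectation (iid_sample n \<nu>)
            (\<lambda>X. (pmf (map_pmf X (pmf_of_set {1..n})) i - pmf \<nu> i) * (pmf (map_pmf X (pmf_of_set {1..n})) j - pmf \<nu> j))
       = (of_bool (i = j) * pmf \<nu> i - pmf \<nu> i * pmf \<nu> j) / real n"
proof -
  have "finite (set_pmf (iid_sample n \<nu>))"
    using set_iid_sample[OF \<nu>] finite_samples by (rule finite_subset)
  then have int: "integrable (measure_pmf (iid_sample n \<nu>)) f" for f :: "_ \<Rightarrow> real"
    by (rule integrable_measure_pmf_finite)
  have dev: "pmf (map_pmf X (pmf_of_set {1..n})) i - pmf \<nu> i = (\<Sum>l\<in>{1..n}. of_bool (X l = i) - pmf \<nu> i) / real n" for X i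
    unfolding pmf_empirical[OF n] using n by (simp add: sum_subtractf diff_divide_distrib)
  have "measure_pmf.expectation (iid_sample n \<nu>)
            (\<lambda>X. (pmf (map_pmf X (pmf_of_set {1..n})) i - pmf \<nu> i) * (pmf (map_pmf X (pmf_of_set {1..n})) j - pmf \<nu> j))
      = measure_pmf.expectation (iid_sample n \<nu>)
         (\<lambda>X. (\<Sum>l\<in>{1..n}. \<Sum>m\<in>{1..n}. (of_bool (X l = i) - pmf \<nu> i) * (of_bool (X m = j) - pmf \<nu> j)) / (real n * real n))"
    unfolding dev times_divide_times_eq sum_product ..
  also have "\<dots> = (\<Sum>l\<in>{1..n}. \<Sum>m\<in>{1..n}. measure_pmf.expectation (iid_sample n \<nu>)
       (\<lambda>X. (of_bool (X l = i) - pmf \<nu> i) * (of_bool (X m = j) - pmf \<nu> j))) / (real n * real n)"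
    by (subst integral_divide_zero, subst Bochner_Integration.integral_sum[OF int],
        subst Bochner_Integration.integral_sum[OF int]) (rule refl)
  also have "\<dots> = (\<Sum>l\<in>{1..n}. \<Sum>m\<in>{1..n}. if l = m then of_bool (i = j) * pmf \<nu> i - pmf \<nu> i * pmf \<nu> j else 0) / (real n * real n)"
    by (simp only: iid_sample_covariance[OF \<nu>] cong: sum.cong)
  also have "\<dots> = (of_bool (i = j) * pmf \<nu> i - pmf \<nu> i * pmf \<nu> j) / real n"
    using n by simp
  finally show ?thesis .
qed

lemma expectation_empirical_distance_form_le:
  assumes \<nu>: "\<nu> \<in> prob_dists k" and n: "n \<ge> 1"
    and D: "\<And>i j. i \<in> {1..k} \<Longrightarrow> j \<in> {1..k} \<Longrightarrow> 0 \<le> D i j \<and> D i j \<le> R"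
  shows "measure_pmf.expectation (iid_sample n \<nu>)
      (\<lambda>X. distance_form {1..k} D (\<lambda>i. pmf (map_pmf X (pmf_of_set {1..n})) i - pmf \<nu> i)) \<le> R / real n"
proof -
  have "finite (set_pmf (iid_sample n \<nu>))"
    using set_iid_sample[OF \<nu>] finite_samples by (rule finite_subset)
  then have int: "integrable (measure_pmf (iid_sample n \<nu>)) f" for f :: "_ \<Rightarrow> real"
    by (rule integrable_measure_pmf_finite)
  have "measure_pmf.expectation (iid_sample n \<nu>)
      (\<lambda>X. distance_form {1..k} D (\<lambda>i. pmf (map_pmf X (pmf_of_set {1..n})) i - pmf \<nu> i))
    = - (\<Sum>i\<in>{1..k}. \<Sum>j\<in>{1..k}. (of_bool (i = j) * pmf \<nu> i - pmf \<nu> i * pmf \<nu> j) / real n * D i j)"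
    unfolding distance_form_def
    by (simp only: Bochner_Integration.integral_minus Bochner_Integration.integral_sum[OF int]
        integral_mult_left_zero empirical_covariance[OF \<nu> n] int)
  also have "\<dots> \<le> (\<Sum>i\<in>{1..k}. \<Sum>j\<in>{1..k}. pmf \<nu> i * pmf \<nu> j * R / real n)"
    unfolding sum_negf[symmetric]
  proof (intro sum_mono)
    fix i j assume ij: "i \<in> {1..k}" "j \<in> {1..k}"
    \<comment> \<open>The diagonal part of the covariance enters with a negative sign and is dropped
      since \<open>D i i >= 0\<close>.\<close>
    have "- ((of_bool (i = j) * pmf \<nu> i - pmf \<nu> i * pmf \<nu> j) / real n * D i j)
        \<le> pmf \<nu> i * pmf \<nu> j / real n * D i j"
      using D[OF ij] by (auto simp: diff_divide_distrib left_diff_distrib)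
    also have "\<dots> \<le> pmf \<nu> i * pmf \<nu> j / real n * R"
      using D[OF ij] by (intro mult_left_mono) auto
    finally show "- ((of_bool (i = j) * pmf \<nu> i - pmf \<nu> i * pmf \<nu> j) / real n * D i j)
        \<le> pmf \<nu> i * pmf \<nu> j * R / real n" by simp
  qed
  also have "\<dots> = (\<Sum>i\<in>{1..k}. pmf \<nu> i) * (\<Sum>j\<in>{1..k}. pmf \<nu> j) * R / real n"
    by (simp only: sum_distrib_left[symmetric] sum_distrib_right[symmetric] sum_divide_distrib[symmetric])
  also have "\<dots> = R / real n"
    by (simp only: prob_dists_sum_eq_1[OF \<nu>])
  finally show ?thesis .
qed

section \<open>From the distance form to the total variation risk\<close>

lemma prob_dists_nonempty: "k \<ge> 1 \<Longrightarrow> prob_dists k \<noteq> {}"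
proof -
  assume "k \<ge> 1"
  then have "return_pmf 1 \<in> prob_dists k" by (simp add: prob_dists_def)
  then show ?thesis by blast
qed

lemma max_tv_risk_least:
  assumes "k \<ge> 1"
    and "\<And>\<nu>. \<nu> \<in> prob_dists k \<Longrightarrow>
        measure_pmf.expectation (iid_sample n \<nu>) (\<lambda>X. (tv_dist (T X) \<nu>)\<^sup>2) \<le> B"
  shows "max_tv_risk k n T \<le> B"
  unfolding max_tv_risk_def using assms by (intro cSUP_least prob_dists_nonempty)

lemma max_tv_risk_le_1: "k \<ge> 1 \<Longrightarrow> max_tv_risk k n T \<le> 1"
proof (rule max_tv_risk_least)
  fix \<nu> assume \<nu>: "\<nu> \<in> prob_dists k"
  have "finite (set_pmf (iid_sample n \<nu>))"
    using set_iid_sample[OF \<nu>] finite_samples by (rule finite_subset)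
  then have "measure_pmf.expectation (iid_sample n \<nu>) (\<lambda>X. (tv_dist (T X) \<nu>)\<^sup>2)
      \<le> measure_pmf.expectation (iid_sample n \<nu>) (\<lambda>X. 1)"
    by (intro integral_mono integrable_measure_pmf_finite) (auto simp: power_le_one tv_dist_nonneg tv_dist_le_1)
  then show "measure_pmf.expectation (iid_sample n \<nu>) (\<lambda>X. (tv_dist (T X) \<nu>)\<^sup>2) \<le> 1"
    by simp
qed

text \<open>Reduction shared by both discrepancies, which differ only in \<open>B\<close>. The error
  splits into estimate minus empirical measure, bounded by \<open>close\<close>, and empirical
  measure minus \<open>\<nu>\<close>, bounded in mean by \<open>R / n\<close>.\<close>

lemma max_tv_risk_le_distance_form:
  assumes k: "k \<ge> 1" and n: "n \<ge> 1" and T: "T \<in> samples k n \<rightarrow> prob_dists k"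
    and D: "\<And>i j. i \<in> {1..k} \<Longrightarrow> j \<in> {1..k} \<Longrightarrow> 0 \<le> D i j \<and> D i j \<le> R"
    and K: "K \<ge> 0"
    and lower: "\<And>w. (\<Sum>i\<in>{1..k}. w i) = 0 \<Longrightarrow> (\<Sum>i\<in>{1..k}. (w i)\<^sup>2) \<le> K * distance_form {1..k} D w"
    and close: "\<And>X. X \<in> samples k n \<Longrightarrow>
      distance_form {1..k} D (\<lambda>i. pmf (T X) i - pmf (map_pmf X (pmf_of_set {1..n})) i) \<le> B"
  shows "max_tv_risk k n T \<le> real k * K * (2 * B + 2 * R / real n)"
proof (rule max_tv_risk_least[OF k])
  fix \<nu> assume \<nu>: "\<nu> \<in> prob_dists k"
  have "finite (set_pmf (iid_sample n \<nu>))"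
    using set_iid_sample[OF \<nu>] finite_samples by (rule finite_subset)
  then have int: "integrable (measure_pmf (iid_sample n \<nu>)) f" for f :: "_ \<Rightarrow> real"
    by (rule integrable_measure_pmf_finite)
  define E where "E X = distance_form {1..k} D (\<lambda>i. pmf (map_pmf X (pmf_of_set {1..n})) i - pmf \<nu> i)" for X
  \<comment> \<open>For \<open>K = 0\<close> the lower bound forces \<open>w\<close> to vanish on
    the alphabet; this case serves alphabets with one letter.\<close>
  have nonneg: "0 \<le> distance_form {1..k} D w" if "(\<Sum>i\<in>{1..k}. w i) = 0" for w
  proof (cases "K = 0")
    case True
    then have "(\<Sum>i\<in>{1..k}. (w i)\<^sup>2) = 0"
      using lower[OF that] sum_nonneg[of "{1..k}" "\<lambda>i. (w i)\<^sup>2"] by simp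
    then have "w i = 0" if "i \<in> {1..k}" for i
      using that by (subst (asm) sum_nonneg_eq_0_iff) auto
    then show ?thesis by (simp add: distance_form_def)
  next
    case False
    have "0 \<le> (\<Sum>i\<in>{1..k}. (w i)\<^sup>2)" by (intro sum_nonneg) simp
    also have "\<dots> \<le> K * distance_form {1..k} D w" by (rule lower[OF that])
    finally show ?thesis using False K by (simp add: zero_le_mult_iff)
  qed
  have pt: "(tv_dist (T X) \<nu>)\<^sup>2 \<le> real k * K * (2 * B + 2 * E X)" if X: "X \<in> samples k n" for X
  proof -
    define e where "e = map_pmf X (pmf_of_set {1..n})"
    have TX: "T X \<in> prob_dists k" using T X by auto
    have e: "e \<in> prob_dists k" unfolding e_def by (rule empirical_in_prob_dists[OF X n])
    note sums = prob_dists_sum_eq_1[OF TX] prob_dists_sum_eq_1[OF e] prob_dists_sum_eq_1[OF \<nu>]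
    have "(tv_dist (T X) \<nu>)\<^sup>2 \<le> real k * (\<Sum>i\<in>{1..k}. (pmf (T X) i - pmf \<nu> i)\<^sup>2)"
      by (rule tv_dist_square_le[OF TX \<nu>])
    also have "\<dots> \<le> real k * (K * distance_form {1..k} D (\<lambda>i. pmf (T X) i - pmf \<nu> i))"
      using sums by (intro mult_left_mono lower) (auto simp: sum_subtractf)
    also have "distance_form {1..k} D (\<lambda>i. pmf (T X) i - pmf \<nu> i)
        = distance_form {1..k} D (\<lambda>i. (pmf (T X) i - pmf e i) + (pmf e i - pmf \<nu> i))"
      by simp
    also have "real k * (K * \<dots>) \<le> real k * (K * (2 * B + 2 * E X))"
    proof (intro mult_left_mono)
      have "distance_form {1..k} D (\<lambda>i. (pmf (T X) i - pmf e i) + (pmf e i - pmf \<nu> i))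
          \<le> 2 * distance_form {1..k} D (\<lambda>i. pmf (T X) i - pmf e i)
            + 2 * distance_form {1..k} D (\<lambda>i. pmf e i - pmf \<nu> i)"
        using sums by (intro distance_form_add_le nonneg) (simp only: sum_subtractf diff_self)
      also have "\<dots> \<le> 2 * B + 2 * E X"
        using close[OF X] by (simp add: e_def E_def)
      finally show "distance_form {1..k} D (\<lambda>i. (pmf (T X) i - pmf e i) + (pmf e i - pmf \<nu> i)) \<le> 2 * B + 2 * E X" .
    qed (use K in auto)
    finally show ?thesis by (simp add: mult.assoc)
  qed
  have "measure_pmf.expectation (iid_sample n \<nu>) (\<lambda>X. (tv_dist (T X) \<nu>)\<^sup>2)
      \<le> measure_pmf.expectation (iid_sample n \<nu>) (\<lambda>X. real k * K * (2 * B + 2 * E X))"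
    using set_iid_sample[OF \<nu>] pt by (intro integral_mono_AE int) (auto simp: AE_measure_pmf_iff)
  also have "\<dots> = real k * K * (2 * B + 2 * measure_pmf.expectation (iid_sample n \<nu>) E)"
    by (simp add: int)
  also have "\<dots> \<le> real k * K * (2 * B + 2 * (R / real n))"
    using expectation_empirical_distance_form_le[OF \<nu> n D] K
    by (intro mult_left_mono add_mono) (auto simp: E_def[abs_def])
  finally show "measure_pmf.expectation (iid_sample n \<nu>) (\<lambda>X. (tv_dist (T X) \<nu>)\<^sup>2)
      \<le> real k * K * (2 * B + 2 * R / real n)" by simp
qed

text \<open>The claimed bounds are 0 when \<open>k = 1\<close>, so the risk must vanish. A weight of
  total mass zero on one point is zero, which allows \<open>D = 0\<close> and
  \<open>K = 0\<close>.\<close>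

lemma max_tv_risk_singleton:
  assumes n: "n \<ge> 1" and T: "T \<in> samples 1 n \<rightarrow> prob_dists 1"
  shows "max_tv_risk 1 n T \<le> 0"
proof -
  have "max_tv_risk 1 n T \<le> real 1 * 0 * (2 * 0 + 2 * 0 / real n)"
    using n T by (intro max_tv_risk_le_distance_form[where D = "\<lambda>_ _. 0"]) (auto simp: distance_form_def)
  then show ?thesis by simp
qed

section \<open>Choice of constants and assembly\<close>

text \<open>Supplies the truncation degree of \<open>distance_form_lower\<close>. The factor 8 is
  generous and gives \<open>sqrt M\<close> the convenient bound
  \<open>2 * sqrt 2 * sqrt (ln k)\<close>.\<close>

lemma exists_power_of_two_above:
  assumes "k \<ge> 2"
  shows "\<exists>M\<ge>1. 2 * real k \<le> 2 ^ M \<and> real M \<le> 8 * ln (real k)"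
proof -
  define M where "M = nat \<lceil>log 2 (2 * real k)\<rceil>"
  have ln_k: "ln 2 \<le> ln (real k)" using assms by simp
  have pos: "log 2 (2 * real k) \<ge> 1"
    using assms by (simp add: log_mult)
  have "2 * real k = 2 powr log 2 (2 * real k)" using assms by simp
  also have "\<dots> \<le> 2 powr real M"
    unfolding M_def by (intro powr_mono) linarith+
  finally have "2 * real k \<le> 2 ^ M" by (simp add: powr_realpow)
  moreover have "real M \<le> 8 * ln (real k)"
  proof -
    have "real M \<le> log 2 (2 * real k) + 1"
      using pos unfolding M_def by linarith
    also have "\<dots> = ln (real k) / ln 2 + 2"
      using assms by (simp add: log_mult) (simp add: log_def)
    also have "\<dots> \<le> ln (real k) / ln 2 + 2 * (ln (real k) / ln 2)"
    proof -
      have "1 \<le> ln (real k) / ln 2" using ln_k by (simp add: le_divide_eq)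
      then show ?thesis by linarith
    qed
    also have "\<dots> = 3 * (ln (real k) / ln 2)" by simp
    also have "\<dots> \<le> 3 * (ln (real k) / (2 / 3))"
      using ln_k ln2_ge_two_thirds by (intro mult_left_mono divide_left_mono) auto
    also have "\<dots> \<le> 8 * ln (real k)" using ln_k ln2_ge_two_thirds by simp
    finally show ?thesis .
  qed
  moreover have "M \<ge> 1" using pos unfolding M_def by linarith
  ultimately show ?thesis by blast
qed

text \<open>\<open>C\<close> sets both the dimension and the risk constant. Since
  \<open>sqrt d\<close> is about \<open>sqrt C * sqrt (ln k)\<close>, the half-space part needs
  roughly \<open>96 * sqrt C <= C\<close>, which 10000 satisfies.\<close>

lemma risk_bounds_alphabet_ge_2:
  fixes k :: nat
  defines "C \<equiv> 10000 :: real"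
  defines "d \<equiv> nat \<lceil>C * ln (real k)\<rceil>"
  assumes k: "k \<ge> 2"
  shows "\<exists>a :: nat \<Rightarrow> real vec. (\<forall>i\<in>{1..k}. a i \<in> carrier_vec d) \<and>
      (\<forall>(n::nat) (c::real) T. n \<ge> 1 \<longrightarrow> c \<ge> 0 \<longrightarrow> T \<in> samples k n \<rightarrow> prob_dists k \<longrightarrow>
        ((\<forall>X\<in>samples k n. energy_dist_sq (map_pmf a (T X)) (empirical a n X) \<le> c / real n) \<longrightarrow>
          max_tv_risk k n T \<le> C * min ((c + 1) * (real k * sqrt (ln (real k)) / real n)) 1) \<and>
        ((\<forall>X\<in>samples k n. (halfspace_dist d (map_pmf a (T X)) (empirical a n X))\<^sup>2 \<le> c / real n) \<longrightarrow>
          max_tv_risk k n T \<le> C * min ((c + 1) * (real k * ln (real k) / real n)) 1))"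
proof -
  define L where "L = ln (real k)"
  have "ln 2 \<le> L" using k by (simp add: L_def)
  then have L: "L \<ge> 2 / 3" using ln2_ge_two_thirds by linarith
  have d_ge: "real d \<ge> C * L" and d_le: "real d \<le> C * L + 1"
    using L unfolding d_def C_def L_def by linarith+
  then have d: "real d > 0" using L by (simp add: C_def)
  have "2 * real k * exp (- real d / 25) < 1"
  proof -
    have "exp (- real d / 25) \<le> exp (- (3 * L))"
      using d_ge L by (simp add: C_def)
    also have "\<dots> = 1 / real k ^ 3"
      using k exp_of_nat_mult[of 3 L] by (simp add: exp_minus L_def inverse_eq_divide)
    finally have "2 * real k * exp (- real d / 25) \<le> 2 * real k * (1 / real k ^ 3)"
      by (intro mult_left_mono) auto
    also have "\<dots> = 2 / (real k * real k)" using k by (simp add: power3_eq_cube)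
    also have "\<dots> \<le> 2 / (2 * 2)" using k by (intro divide_left_mono mult_mono) auto
    finally show ?thesis by simp
  qed
  from nearly_orthogonal_signs_exist[OF this] obtain y :: "nat \<Rightarrow> nat \<Rightarrow> real"
    where y: "\<forall>i\<in>{1..k}. y i \<in> {..<d} \<rightarrow>\<^sub>E {-1, 1}"
      and orth: "\<forall>i\<in>{1..k}. \<forall>j\<in>{1..k}. i \<noteq> j \<longrightarrow> \<bar>\<Sum>l<d. y i l * y j l\<bar> \<le> real d / 2"
    by (elim exE conjE)
  define x where "x i l = y i l / sqrt (real d)" for i l
  define s where "s i j = (\<Sum>l<d. x i l * x j l)" for i j
  define a where "a i = vec d (x i)" for i
  define D where "D i j = eucl_norm (a i - a j)" for i j
  have a: "a i \<in> carrier_vec d" for i by (simp add: a_def)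
  have s_eq: "s i j = (\<Sum>l<d. y i l * y j l) / real d" for i j
    by (simp add: s_def x_def sum_divide_distrib)
  have s_diag: "s i i = 1" if "i \<in> {1..k}" for i
  proof -
    have "y i l * y i l = 1" if "l < d" for l
      using y[rule_format, OF \<open>i \<in> {1..k}\<close>] that by (auto dest!: PiE_mem[of _ _ _ l])
    then show ?thesis using d by (simp add: s_eq)
  qed
  have s_off: "\<bar>s i j\<bar> \<le> 1 / 2" if "i \<in> {1..k}" "j \<in> {1..k}" "i \<noteq> j" for i j
    using orth[rule_format, OF that] d by (simp add: s_eq field_simps)
  have D_eq: "D i j = sqrt (\<Sum>l<d. (x i l - x j l)\<^sup>2)" for i j
    by (simp add: D_def a_def eucl_norm_def scalar_prod_def power2_eq_square lessThan_atLeast0)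
  have D_eq_s: "D i j = sqrt 2 * sqrt (1 - s i j)" if "i \<in> {1..k}" "j \<in> {1..k}" for i j
  proof -
    have "(\<Sum>l<d. (x i l - x j l)\<^sup>2) = s i i + s j j - 2 * s i j"
      by (simp add: s_def power2_eq_square algebra_simps sum.distrib sum_subtractf sum_distrib_left)
    then show ?thesis
      using s_diag that by (simp add: D_eq flip: real_sqrt_mult)
  qed
  have D_bounds: "0 \<le> D i j \<and> D i j \<le> 2" if "i \<in> {1..k}" "j \<in> {1..k}" for i j
  proof -
    have "-1 \<le> s i j \<and> s i j \<le> 1"
    proof (cases "i = j")
      case True
      then show ?thesis using s_diag that by simp
    next
      case False
      from s_off[OF that False] show ?thesis by linarith
    qed
    then show ?thesis
      using real_sqrt_le_mono[of "2 * (1 - s i j)" "2\<^sup>2"] by (simp add: D_eq_s[OF that] flip: real_sqrt_mult)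
  qed
  have lower: "(\<Sum>i\<in>{1..k}. (w i)\<^sup>2) \<le> 8 * sqrt L * distance_form {1..k} D w"
    if w: "(\<Sum>i\<in>{1..k}. w i) = 0" for w
  proof -
    obtain M where M: "M \<ge> 1" "2 * real k \<le> 2 ^ M" "real M \<le> 8 * L"
      using exists_power_of_two_above[OF k] unfolding L_def by blast
    \<comment> \<open>The factor \<open>sqrt 2\<close> is kept apart because it is the one between
      \<open>D\<close> and \<open>sqrt (1 - s i j)\<close>.\<close>
    have "sqrt (real M) \<le> sqrt 2 * (2 * sqrt L)"
    proof -
      have "sqrt (real M) \<le> sqrt (2 * (4 * L))" using M by simp
      also have "\<dots> = sqrt 2 * (2 * sqrt L)" by (simp only: real_sqrt_mult real_sqrt_four)
      finally show ?thesis .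
    qed
    have sqM: "sqrt (real M) > 0" using M by simp
    define G where "G = distance_form {1..k} (\<lambda>i j. sqrt (1 - s i j)) w"
    have "(\<Sum>i\<in>{1..k}. (w i)\<^sup>2) / (4 * sqrt (real M)) \<le> G"
      unfolding G_def
      by (rule distance_form_lower[where x = x and L = "{..<d}"])
        (use s_diag s_off w M in \<open>auto simp: s_def\<close>)
    moreover have "0 \<le> (\<Sum>i\<in>{1..k}. (w i)\<^sup>2) / (4 * sqrt (real M))"
      by (intro divide_nonneg_nonneg sum_nonneg) auto
    ultimately have G: "G \<ge> 0" by linarith
    have "(\<Sum>i\<in>{1..k}. (w i)\<^sup>2) \<le> 4 * sqrt (real M) * G"
      using \<open>(\<Sum>i\<in>{1..k}. (w i)\<^sup>2) / (4 * sqrt (real M)) \<le> G\<close> sqM by (simp add: field_simps)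
    with G have "(\<Sum>i\<in>{1..k}. (w i)\<^sup>2) \<le> 4 * (sqrt 2 * (2 * sqrt L)) * G"
      using \<open>sqrt (real M) \<le> sqrt 2 * (2 * sqrt L)\<close>
      by (smt (verit) mult_right_mono)
    also have "\<dots> = 8 * sqrt L * (sqrt 2 * G)" by simp
    also have "sqrt 2 * G = distance_form {1..k} (\<lambda>i j. sqrt 2 * sqrt (1 - s i j)) w"
      by (simp add: G_def distance_form_scale)
    also have "\<dots> = distance_form {1..k} D w"
      unfolding distance_form_def using D_eq_s by (intro arg_cong[of _ _ uminus] sum.cong) auto
    finally show ?thesis .
  qed
  have risk: "max_tv_risk k n T \<le> real k * (8 * sqrt L) * (2 * B + 2 * 2 / real n)"
    if "n \<ge> 1" "T \<in> samples k n \<rightarrow> prob_dists k"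
      "\<And>X. X \<in> samples k n \<Longrightarrow>
        distance_form {1..k} D (\<lambda>i. pmf (T X) i - pmf (map_pmf X (pmf_of_set {1..n})) i) \<le> B" for n T B
    by (rule max_tv_risk_le_distance_form[where D = D])
      (use that k L lower D_bounds in auto)
  \<comment> \<open>The risk never exceeds 1, hence never \<open>C\<close>, so the minimum comes for
    free.\<close>
  have combine: "max_tv_risk k n T \<le> C * min z 1" if "max_tv_risk k n T \<le> C * z" for n T z
    using that max_tv_risk_le_1[of k n T] k by (simp add: C_def min_def)
  show ?thesis
  proof (intro exI[of _ a] conjI ballI allI impI)
    show "a i \<in> carrier_vec d" for i by (rule a)
  next
    fix n :: nat and c :: real and T
    assume n: "n \<ge> 1" and c: "c \<ge> 0" and T: "T \<in> samples k n \<rightarrow> prob_dists k"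
      and close: "\<forall>X\<in>samples k n. energy_dist_sq (map_pmf a (T X)) (empirical a n X) \<le> c / real n"
    have "max_tv_risk k n T \<le> real k * (8 * sqrt L) * (2 * (c / real n) + 2 * 2 / real n)"
    proof (rule risk[OF n T])
      fix X assume X: "X \<in> samples k n"
      then have "T X \<in> prob_dists k" using T by auto
      from energy_dist_sq_eq_distance_form[OF this empirical_in_prob_dists[OF X n], of a, OF a]
        bspec[OF close X]
      show "distance_form {1..k} D (\<lambda>i. pmf (T X) i - pmf (map_pmf X (pmf_of_set {1..n})) i) \<le> c / real n"
        by (simp add: D_def[abs_def] empirical_eq_map)
    qed
    also have "\<dots> = (16 * c + 32) * (real k * sqrt L / real n)"
      using n by (simp add: field_simps)
    also have "\<dots> \<le> (C * (c + 1)) * (real k * sqrt L / real n)"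
      using c L by (intro mult_right_mono) (auto simp: C_def)
    finally have "max_tv_risk k n T \<le> C * ((c + 1) * (real k * sqrt (ln (real k)) / real n))"
      by (simp add: L_def mult.assoc)
    then show "max_tv_risk k n T \<le> C * min ((c + 1) * (real k * sqrt (ln (real k)) / real n)) 1"
      by (rule combine)
  next
    fix n :: nat and c :: real and T
    assume n: "n \<ge> 1" and c: "c \<ge> 0" and T: "T \<in> samples k n \<rightarrow> prob_dists k"
      and close: "\<forall>X\<in>samples k n. (halfspace_dist d (map_pmf a (T X)) (empirical a n X))\<^sup>2 \<le> c / real n"
    have "max_tv_risk k n T \<le> real k * (8 * sqrt L) * (2 * (6 * sqrt (real d) * (c / real n)) + 2 * 2 / real n)"
    proof (rule risk[OF n T])
      fix X assume X: "X \<in> samples k n"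
      define e where "e = map_pmf X (pmf_of_set {1..n})"
      define M where "M = halfspace_dist d (map_pmf a (T X)) (map_pmf a e)"
      have TX: "T X \<in> prob_dists k" using T X by auto
      have e: "e \<in> prob_dists k" unfolding e_def by (rule empirical_in_prob_dists[OF X n])
      have "distance_form {1..k} (\<lambda>i j. sqrt (\<Sum>l<d. (x i l - x j l)\<^sup>2)) (\<lambda>i. pmf (T X) i - pmf e i)
          \<le> 6 * sqrt (real d) * M\<^sup>2"
      proof (rule distance_form_halfspace_le)
        show "(\<Sum>i\<in>{1..k}. pmf (T X) i - pmf e i) = 0"
          using prob_dists_sum_eq_1[OF TX] prob_dists_sum_eq_1[OF e] by (simp add: sum_subtractf)
        show "(\<Sum>l<d. (x i l)\<^sup>2) \<le> 1" if "i \<in> {1..k}" for i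
          using s_diag[OF that] by (simp add: s_def power2_eq_square)
        show "\<bar>\<Sum>i\<in>{i\<in>{1..k}. b \<le> (\<Sum>l<d. x i l * v l)}. pmf (T X) i - pmf e i\<bar> \<le> M" for v b
          using halfspace_dist_ge[OF TX e, of a d "vec d v" b, OF a]
          by (simp add: M_def a_def scalar_prod_def lessThan_atLeast0)
      qed (use d in auto)
      also have "\<dots> \<le> 6 * sqrt (real d) * (c / real n)"
        using close X by (intro mult_left_mono) (auto simp: M_def e_def empirical_eq_map)
      finally show "distance_form {1..k} D (\<lambda>i. pmf (T X) i - pmf (map_pmf X (pmf_of_set {1..n})) i)
          \<le> 6 * sqrt (real d) * (c / real n)"
        by (simp add: D_eq[abs_def] e_def)
    qed
    \<comment> \<open>The constants are \<open>8 * 2 * 6\<close> and \<open>8 * 2 * 2\<close>. One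
      \<open>sqrt L\<close> comes from the lower bound on the form, the other will come from
      \<open>sqrt d\<close>.\<close>
    also have "\<dots> = (96 * sqrt (real d) * c + 32) * (sqrt L * (real k / real n))"
      using n by (simp add: field_simps)
    also have "\<dots> \<le> (C * (c + 1) * sqrt L) * (sqrt L * (real k / real n))"
    proof (intro mult_right_mono)
      \<comment> \<open>\<open>C * L + 1 <= 101^2 * L\<close> because \<open>L >= 2/3\<close>; then
        \<open>96 * 101 = 9696\<close> stays below \<open>C\<close>.\<close>
      have "sqrt (real d) \<le> sqrt (101\<^sup>2 * L)"
        using d_le L by (simp add: C_def)
      then have "sqrt (real d) \<le> 101 * sqrt L"
        by (simp add: real_sqrt_mult)
      moreover have "0 \<le> sqrt L" using L by simp
      ultimately have "96 * sqrt (real d) \<le> C * sqrt L"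
        unfolding C_def by linarith
      then have "96 * sqrt (real d) * c \<le> C * sqrt L * c"
        using c by (rule mult_right_mono)
      \<comment> \<open>The term 32 carries no \<open>sqrt d\<close>, so a lower bound on
        \<open>sqrt L\<close> has to absorb it.\<close>
      moreover have "1 / 2 \<le> sqrt L"
        using L by (intro real_le_rsqrt) (simp add: power2_eq_square)
      then have "32 \<le> C * sqrt L" by (simp add: C_def)
      ultimately show "96 * sqrt (real d) * c + 32 \<le> C * (c + 1) * sqrt L"
        by (simp add: algebra_simps)
    qed (use L in auto)
    also have "\<dots> = C * ((c + 1) * (real k * (sqrt L * sqrt L) / real n))"
      by simp
    also have "sqrt L * sqrt L = ln (real k)"
      using L by (simp add: L_def)
    finally have "max_tv_risk k n T \<le> C * ((c + 1) * (real k * ln (real k) / real n))" .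
    then show "max_tv_risk k n T \<le> C * min ((c + 1) * (real k * ln (real k) / real n)) 1"
      by (rule combine)
  qed
qed

theorem theorem10:
  shows "\<exists>C::real. C > 0 \<and> (\<forall>k::nat. k \<ge> 1 \<longrightarrow>
    (\<exists>a :: nat \<Rightarrow> real vec. (\<forall>i\<in>{1..k}. a i \<in> carrier_vec (nat \<lceil>C * ln (real k)\<rceil>)) \<and>
      (\<forall>(n::nat) (c::real) T. n \<ge> 1 \<longrightarrow> c \<ge> 0 \<longrightarrow> T \<in> samples k n \<rightarrow> prob_dists k \<longrightarrow>
        ((\<forall>X\<in>samples k n. energy_dist_sq (map_pmf a (T X)) (empirical a n X) \<le> c / real n) \<longrightarrow>
          max_tv_risk k n T \<le> C * min ((c + 1) * (real k * sqrt (ln (real k)) / real n)) 1) \<and>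
        ((\<forall>X\<in>samples k n.
            (halfspace_dist (nat \<lceil>C * ln (real k)\<rceil>) (map_pmf a (T X)) (empirical a n X))\<^sup>2
              \<le> c / real n) \<longrightarrow>
          max_tv_risk k n T \<le> C * min ((c + 1) * (real k * ln (real k) / real n)) 1))))"
proof (rule exI[of _ 10000], intro conjI allI impI, goal_cases)
  case (2 k)
  show ?case
  proof (cases "k = 1")
    case True
    \<comment> \<open>Here \<open>ln k = 0\<close>, so the points lie in dimension 0 and the bounds
      to be shown are 0.\<close>
    then show ?thesis
      using max_tv_risk_singleton by (intro exI[of _ "\<lambda>_. vec 0 (\<lambda>_. 0)"]) auto
  next
    case False
    with 2 have "k \<ge> 2" by simp
    then show ?thesis by (rule risk_bounds_alphabet_ge_2)
  qed
qed simp

end
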